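(* Consider the Multilevel BDDC preconditioner $B:r_1\in U_1'\mapsto u_1\in U_1$ with $L\ge2$ levels, as defined in the context. If for some constants $\omega_i\ge1$, $$\|(I-P_i)E_iw_i\|_a^2\le\omega_i\|w_i\|_a^2\qquad\forall w_i\in\widetilde W_i,\quad i=1,\dots,L-1,$$ then $$\kappa=\frac{\lambda_{\max}(BA)}{\lambda_{\min}(BA)}\le\prod_{i=1}^{L-1}\omega_i ,$$ where $A:U_1\to U_1'$ is given by $\langle Au,v\rangle=a(u,v)$ for all $u,v\in U_1$.
   Context: All spaces are finite dimensional; $\langle\cdot,\cdot\rangle$ is the duality pairing, a prime denotes the dual space, and $\|w\|_a^2=a(w,w)$. Level 1 problem. $\Omega\subset\mathbb R^d$, $d=2$ or $3$, is a bounded domain decomposed into nonoverlapping level $1$ substructures $\Omega_1^s$, $s=1,\dots,N_1$, forming a conforming triangulation; each is a union of Lagrangian $P1$ or $Q1$ finite elements $\Omega_0^s$ (with nodes coinciding between substructures). $W_1^s$ is the space of finite element functions on $\Omega_1^s$ whose degrees of freedom on $\partial\Omega_1^s\cap\partial\Omega$ are zero, $W_1=W_1^1\times\cdots\times W_1^{N_1}$, and $a(u,v)=\sum_{s=1}^{N_1}\int_{\Omega_1^s}\nabla u\cdot\nabla v\,dx$ for $u,v\in W_1$. $U_1=U\subset W_1$ is the subspace of functions continuous across substructure interfaces; $a$ is positive definite on $U$. Hierarchy. For $i\ge2$, level $i-1$ substructures are the level $i$ elements, level $i-1$ coarse degrees of freedom are the level $i$ degrees of freedom, and $U_i=\widetilde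 W_{\Pi,i-1}$ (defined below). Level $i$ substructures $\Omega_i^s$, $s=1,\dots,N_i$, are agglomerates of level $i$ elements and form a conforming triangulation. $\Gamma_i$ is the set of nodes (carrying level $i$ degrees of freedom) shared by at least two level $i$ substructures; $\Gamma_i\subset\Gamma_{i-1}$. $W_i^s$ is the space of functions on $\Omega_i^s$ (spanned by the level $i$ shape functions) whose degrees of freedom on $\partial\Omega_i^s\cap\partial\Omega$ are zero, and $W_i=W_i^1\times\cdots\times W_i^{N_i}$; $U_i\subset W_i$ is the subspace of functions continuous across $\Gamma_i$ (in the sense of the level $i$ degrees of freedom). The form $a$ is evaluated by piecewise integration. For each $i=1,\dots,L-1$: $U_{Ii}\subset U_i$ is the subspace of functions that are zero on $\Gamma_i$. $P_i:W_i\to U_{Ii}$ is the $a$-orthogonal projection: $a(P_iw,z)=a(w,z)$ for all $z\in U_{Ii}$. Certain linear functionals are selected as level $i$ coarse degrees of freedom (such as values at corners, averages over edges or faces of level $i$ substructures). $\widetilde W_i\subset W_i$ is the subspace of functions whose level $i$ coarse degrees of freedom have a common value for all relevant level $i$ substructures and vanish on $\partial\Omega$; $\widetilde W_{\Delta i}\subset W_i$ is the subspace of functions whose level $i$ coarse degrees of freedom vanish; $\widetilde W_{\Pi i}\subset\widetilde W_i$ is the subspace of functions of minimal energy for given values of their level $i$ coarse degrees of freedom. Thus $\widetilde W_i=\widetilde W_{\Delta i}\oplus\widetilde W_{\Pi i}$ with $\widetilde W_{\Delta i}\perp_a\widetilde W_{\Pi i}$. Standing assumptions: $a$ is positive definite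 on $\widetilde W_i$; $U_{Ii}\subset\widetilde W_{\Delta i}$; and $E_i:\widetilde W_i\to U_i$ is a linear projection onto $U_i$ ($E_i^2=E_i$, $E_iu=u$ for $u\in U_i$), defined by some weighted average on $\Gamma_i$, so in particular $E_iU_{Ii}=U_{Ii}$. Multilevel BDDC preconditioner $r_1\in U_1'\mapsto u_1\in U_1$. For $i=1,\dots,L-1$: find $u_{Ii}\in U_{Ii}$ with $a(u_{Ii},z)=\langle r_i,z\rangle$ for all $z\in U_{Ii}$; define $r_{Bi}\in U_i'$ by $\langle r_{Bi},v\rangle=\langle r_i,v\rangle-a(u_{Ii},v)$ for all $v\in U_i$; find $w_{\Delta i}\in\widetilde W_{\Delta i}$ with $a(w_{\Delta i},z)=\langle r_{Bi},E_iz\rangle$ for all $z\in\widetilde W_{\Delta i}$; if $i=L-1$, find $w_{\Pi,L-1}\in\widetilde W_{\Pi,L-1}$ with $a(w_{\Pi,L-1},z)=\langle r_{B,L-1},E_{L-1}z\rangle$ for all $z\in\widetilde W_{\Pi,L-1}$ and set $u_L=w_{\Pi,L-1}$; otherwise define $r_{i+1}\in U_{i+1}'=\widetilde W_{\Pi i}'$ by $\langle r_{i+1},z\rangle=\langle r_{Bi},E_iz\rangle$ for all $z\in\widetilde W_{\Pi i}=U_{i+1}$. Then for $i=L-1,\dots,1$: set $u_{Bi}=E_i(w_{\Delta i}+u_{i+1})$; find $v_{Ii}\in U_{Ii}$ with $a(v_{Ii},z)=a(u_{Bi},z)$ for all $z\in U_{Ii}$; set $u_i=u_{Ii}+u_{Bi}-v_{Ii}$.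 *)

theory Defs
  imports "HOL-Analysis.Analysis" "HOL-Library.Function_Algebras" "HOL-Library.FuncSet"
begin

instantiation "fun" :: (type, scaleR) scaleR
begin

definition scaleR_fun_def: "c *\<^sub>R f = (\<lambda>x. c *\<^sub>R f x)"

instance ..

end

instance "fun" :: (type, real_vector) real_vector
  by standard (simp_all add: scaleR_fun_def plus_fun_def fun_eq_iff scaleR_add_right scaleR_add_left)

definition linear_map_on :: "'a::real_vector set \<Rightarrow> ('a \<Rightarrow> 'b::real_vector) \<Rightarrow> bool" where
  "linear_map_on V f \<longleftrightarrow>
     (\<forall>x\<in>V. \<forall>y\<in>V. f (x + y) = f x + f y) \<and> (\<forall>c. \<forall>x\<in>V. f (c *\<^sub>R x) = c *\<^sub>R f x)"

text \<open>Functionals on a subspace are total HOL functions; extensionality makes them unique.\<close>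

definition dual :: "'a::real_vector set \<Rightarrow> ('a \<Rightarrow> real) set" where
  "dual V = {r \<in> extensional V. linear_map_on V r}"

definition eigenvalues_on :: "'a::real_vector set \<Rightarrow> ('a \<Rightarrow> 'a) \<Rightarrow> real set" where
  "eigenvalues_on V T = {l. \<exists>u\<in>V. u \<noteq> 0 \<and> T u = l *\<^sub>R u}"

text \<open>
  The field \<open>shapes\<close> contains total functions; only their values on \<open>cell\<close> are constrained.
\<close>

record ('d::finite) fe =
  cell :: "(real ^ 'd) set"
  faces :: "(real ^ 'd) set set"
  nodes :: "(real ^ 'd) set"
  shapes :: "(real ^ 'd \<Rightarrow> real) set"

definition P1_element :: "('d::finite) fe \<Rightarrow> bool" where
  "P1_element e \<longleftrightarrow>
     finite (nodes e) \<and> card (nodes e) = CARD('d) + 1 \<and> \<not> affine_dependent (nodes e) \<and>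
     cell e = convex hull (nodes e) \<and>
     faces e = {f. f face_of cell e} \<and>
     shapes e = {v. \<exists>c b. \<forall>x\<in>cell e. v x = c \<bullet> x + b}"

text \<open>Polynomials of degree at most one in each coordinate.\<close>

definition Q1_poly :: "(real ^ 'd::finite \<Rightarrow> real) set" where
  "Q1_poly = {q. \<exists>c. \<forall>x. q x = (\<Sum>S\<in>UNIV. c S * (\<Prod>j\<in>S. x $ j))}"

text \<open>
  Isoparametric elements: \<open>F\<close> maps the reference unit cube onto the cell. This includes
  axis-parallel boxes and parallelepipeds (\<open>F\<close> affine).
\<close>

definition Q1_element :: "('d::finite) fe \<Rightarrow> bool" where
  "Q1_element e \<longleftrightarrow>
     (\<exists>F :: real ^ 'd \<Rightarrow> real ^ 'd.
        (\<forall>j. (\<lambda>x. F x $ j) \<in> Q1_poly) \<and>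
        inj_on F (cbox 0 1) \<and>
        (\<forall>x\<in>cbox 0 1. det (matrix (frechet_derivative F (at x))) \<noteq> 0) \<and>
        cell e = F ` cbox 0 1 \<and>
        faces e = {F ` f |f. f face_of cbox 0 1} \<and>
        nodes e = F ` {x. \<forall>j. x $ j \<in> {0, 1}} \<and>
        shapes e = {v. \<exists>q\<in>Q1_poly. \<forall>x\<in>cbox 0 1. v (F x) = q x})"

text \<open>
  A function on the union of the level 1 substructures that may be discontinuous across their
  interfaces is a family \<open>w\<close> with \<open>w s\<close> the function on the level 1 substructure \<open>s\<close>. Since level
  \<open>i\<close> shape functions are energy-minimal functions of level \<open>i - 1\<close>, the spaces of all levels
  consist of such families.
\<close>

type_synonym 'd field = "nat \<Rightarrow> real ^ 'd \<Rightarrow> real"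

text \<open>
  Level \<open>i\<close> substructures are numbered \<open>1, \<dots>, num i\<close>; level 0 substructures are the finite
  elements. Substructure \<open>s\<close> of level \<open>i\<close> is the agglomerate of the level \<open>i - 1\<close> substructures in
  \<open>agg i s\<close>. The level \<open>i\<close> coarse degree of freedom \<open>k \<in> cdofs i\<close> lives on the set \<open>cloc i k\<close> of
  mesh nodes (one node for a corner, all nodes of an edge or a face for an average), and
  \<open>cfun i k s\<close> is its functional on functions on the level \<open>i\<close> substructure \<open>s\<close>.
\<close>

record ('d::finite) hierarchy =
  region :: "(real ^ 'd) set"
  levels :: nat
  num :: "nat \<Rightarrow> nat"
  elt :: "nat \<Rightarrow> 'd fe"
  nnodes :: nat
  node :: "nat \<Rightarrow> real ^ 'd"
  agg :: "nat \<Rightarrow> nat \<Rightarrow> nat set"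
  cdofs :: "nat \<Rightarrow> nat set"
  cloc :: "nat \<Rightarrow> nat \<Rightarrow> (real ^ 'd) set"
  cfun :: "nat \<Rightarrow> nat \<Rightarrow> nat \<Rightarrow> 'd field \<Rightarrow> real"
  avg :: "nat \<Rightarrow> 'd field \<Rightarrow> 'd field"

fun Om :: "('d::finite) hierarchy \<Rightarrow> nat \<Rightarrow> nat \<Rightarrow> (real ^ 'd) set" where
  "Om H 0 t = cell (elt H t)"
| "Om H (Suc i) s = (\<Union>t\<in>agg H (Suc i) s. Om H i t)"

text \<open>The level 1 substructures contained in a substructure of level \<open>i \<ge> 1\<close>.\<close>

fun leaves :: "('d::finite) hierarchy \<Rightarrow> nat \<Rightarrow> nat \<Rightarrow> nat set" where
  "leaves H 0 s = {}"
| "leaves H (Suc 0) s = {s}"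
| "leaves H (Suc (Suc i)) s = (\<Union>t\<in>agg H (Suc (Suc i)) s. leaves H (Suc i) t)"

definition component :: "('d::finite) hierarchy \<Rightarrow> nat \<Rightarrow> nat \<Rightarrow> 'd field \<Rightarrow> 'd field" where
  "component H i s w = (\<lambda>t. if t \<in> leaves H i s then w t else 0)"

definition conforming_mesh :: "('d::finite) hierarchy \<Rightarrow> bool" where
  "conforming_mesh H \<longleftrightarrow>
     (\<forall>t\<in>{1..num H 0}. P1_element (elt H t) \<or> Q1_element (elt H t)) \<and>
     closure (region H) = (\<Union>t\<in>{1..num H 0}. cell (elt H t)) \<and>
     (\<forall>t\<in>{1..num H 0}. interior (cell (elt H t)) \<subseteq> region H) \<and>
     (\<forall>t\<in>{1..num H 0}. \<forall>t'\<in>{1..num H 0}. t \<noteq> t' \<longrightarrow>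
        interior (cell (elt H t)) \<inter> interior (cell (elt H t')) = {} \<and>
        cell (elt H t) \<inter> cell (elt H t') \<in> faces (elt H t) \<inter> faces (elt H t') \<and>
        nodes (elt H t) \<inter> cell (elt H t') = nodes (elt H t') \<inter> cell (elt H t)) \<and>
     bij_betw (node H) {1..nnodes H} (\<Union>t\<in>{1..num H 0}. nodes (elt H t))"

definition agglomeration :: "('d::finite) hierarchy \<Rightarrow> nat \<Rightarrow> bool" where
  "agglomeration H i \<longleftrightarrow>
     (\<forall>s\<in>{1..num H i}. agg H i s \<noteq> {}) \<and>
     disjoint_family_on (agg H i) {1..num H i} \<and>
     (\<Union>s\<in>{1..num H i}. agg H i s) = {1..num H (i - 1)}"

text \<open>
  The substructures relevant for a coarse degree of freedom are those that contain the corner,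
  edge or face on which it lives.
\<close>

definition relevant :: "('d::finite) hierarchy \<Rightarrow> nat \<Rightarrow> nat \<Rightarrow> nat \<Rightarrow> bool" where
  "relevant H i k s \<longleftrightarrow> cloc H i k \<subseteq> Om H i s"

definition cdof :: "('d::finite) hierarchy \<Rightarrow> nat \<Rightarrow> nat \<Rightarrow> nat \<Rightarrow> 'd field \<Rightarrow> real" where
  "cdof H i k s w = cfun H i k s (component H i s w)"

definition on_boundary :: "('d::finite) hierarchy \<Rightarrow> nat \<Rightarrow> nat \<Rightarrow> bool" where
  "on_boundary H i k \<longleftrightarrow> cloc H i k \<subseteq> frontier (region H)"

text \<open>
  The degrees of freedom of level 1 are the nodal values, those of level \<open>i \<ge> 2\<close> are the coarse
  degrees of freedom of level \<open>i - 1\<close>.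
\<close>

definition dofs :: "('d::finite) hierarchy \<Rightarrow> nat \<Rightarrow> nat set" where
  "dofs H i = (if i \<le> 1 then {1..nnodes H} else cdofs H (i - 1))"

definition dof_loc :: "('d::finite) hierarchy \<Rightarrow> nat \<Rightarrow> nat \<Rightarrow> (real ^ 'd) set" where
  "dof_loc H i k = (if i \<le> 1 then {node H k} else cloc H (i - 1) k)"

definition carries :: "('d::finite) hierarchy \<Rightarrow> nat \<Rightarrow> nat \<Rightarrow> nat \<Rightarrow> bool" where
  "carries H i k s \<longleftrightarrow>
     (if i \<le> 1 then node H k \<in> Om H i s else \<exists>t\<in>agg H i s. relevant H (i - 1) k t)"

text \<open>
  The value of the level \<open>i\<close> degree of freedom \<open>k\<close> on the substructure \<open>s\<close>. For \<open>i \<ge> 2\<close> it is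
  evaluated on a level \<open>i\<close> element of \<open>s\<close> carrying \<open>k\<close>; functions in \<open>W_loc H i s\<close> below have the
  same value on all of them.
\<close>

definition dof :: "('d::finite) hierarchy \<Rightarrow> nat \<Rightarrow> nat \<Rightarrow> nat \<Rightarrow> 'd field \<Rightarrow> real" where
  "dof H i k s w =
     (if i \<le> 1 then w s (node H k)
      else cdof H (i - 1) k (SOME t. t \<in> agg H i s \<and> relevant H (i - 1) k t) w)"

definition Gamma :: "('d::finite) hierarchy \<Rightarrow> nat \<Rightarrow> nat set" where
  "Gamma H i = {k \<in> dofs H i. \<exists>s\<in>{1..num H i}. \<exists>s'\<in>{1..num H i}.
     s \<noteq> s' \<and> carries H i k s \<and> carries H i k s'}"

definition Gamma_points :: "('d::finite) hierarchy \<Rightarrow> nat \<Rightarrow> (real ^ 'd) set" where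
  "Gamma_points H i = (\<Union>k\<in>Gamma H i. dof_loc H i k)"

text \<open>
  The gradient exists in the interior of every element, that is, almost everywhere; its values
  elsewhere do not affect the integral.
\<close>

definition grad :: "(real ^ 'd::finite \<Rightarrow> real) \<Rightarrow> real ^ 'd \<Rightarrow> real ^ 'd" where
  "grad u x = (\<chi> j. frechet_derivative u (at x) (axis j 1))"

definition form :: "('d::finite) hierarchy \<Rightarrow> 'd field \<Rightarrow> 'd field \<Rightarrow> real" where
  "form H u v = (\<Sum>s\<in>{1..num H 1}. integral (Om H 1 s) (\<lambda>x. grad (u s) x \<bullet> grad (v s) x))"

definition energy :: "('d::finite) hierarchy \<Rightarrow> 'd field \<Rightarrow> real" where
  "energy H w = form H w w"

definition posdef_on :: "('d::finite) hierarchy \<Rightarrow> 'd field set \<Rightarrow> bool" where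
  "posdef_on H V \<longleftrightarrow> (\<forall>w\<in>V. w \<noteq> 0 \<longrightarrow> form H w w > 0)"

definition min_energy ::
  "('d::finite) hierarchy \<Rightarrow> 'd field set \<Rightarrow> ('d field \<Rightarrow> 'd field \<Rightarrow> bool) \<Rightarrow> 'd field set" where
  "min_energy H V same = {w \<in> V. \<forall>z\<in>V. same z w \<longrightarrow> energy H w \<le> energy H z}"

definition same_cdofs_on ::
  "('d::finite) hierarchy \<Rightarrow> nat \<Rightarrow> nat \<Rightarrow> 'd field \<Rightarrow> 'd field \<Rightarrow> bool" where
  "same_cdofs_on H i s z w \<longleftrightarrow>
     (\<forall>k\<in>cdofs H i. relevant H i k s \<longrightarrow> cdof H i k s z = cdof H i k s w)"

text \<open>
  The space \<open>W_loc H i s\<close> of functions on the level \<open>i\<close> substructure \<open>s\<close>. The level \<open>i + 1\<close> shape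
  functions on the level \<open>i + 1\<close> element \<open>t\<close> span the space of functions on the level \<open>i\<close>
  substructure \<open>t\<close> of minimal energy for given level \<open>i\<close> coarse degrees of freedom. A function on
  a level \<open>i + 1\<close> substructure is composed of such functions with common degrees of freedom.
\<close>

fun W_loc :: "('d::finite) hierarchy \<Rightarrow> nat \<Rightarrow> nat \<Rightarrow> 'd field set" where
  "W_loc H 0 s = {}"
| "W_loc H (Suc 0) s = {w.
     component H (Suc 0) s w = w \<and>
     (\<forall>x. x \<notin> Om H (Suc 0) s \<longrightarrow> w s x = 0) \<and>
     (\<forall>t\<in>agg H (Suc 0) s. w s \<in> shapes (elt H t)) \<and>
     (\<forall>k\<in>{1..nnodes H}. node H k \<in> Om H (Suc 0) s \<inter> frontier (region H) \<longrightarrow> w s (node H k) = 0)}"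
| "W_loc H (Suc (Suc i)) s = {w.
     component H (Suc (Suc i)) s w = w \<and>
     (\<forall>t\<in>agg H (Suc (Suc i)) s.
        component H (Suc i) t w \<in> min_energy H (W_loc H (Suc i) t) (same_cdofs_on H (Suc i) t)) \<and>
     (\<forall>k\<in>cdofs H (Suc i). \<forall>t\<in>agg H (Suc (Suc i)) s. \<forall>t'\<in>agg H (Suc (Suc i)) s.
        relevant H (Suc i) k t \<and> relevant H (Suc i) k t' \<longrightarrow>
        cdof H (Suc i) k t w = cdof H (Suc i) k t' w) \<and>
     (\<forall>k\<in>cdofs H (Suc i). \<forall>t\<in>agg H (Suc (Suc i)) s.
        relevant H (Suc i) k t \<and> on_boundary H (Suc i) k \<longrightarrow> cdof H (Suc i) k t w = 0)}"

definition W_space :: "('d::finite) hierarchy \<Rightarrow> nat \<Rightarrow> 'd field set" where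
  "W_space H i = {w. (\<forall>s\<in>{1..num H i}. component H i s w \<in> W_loc H i s) \<and>
               (\<forall>t. t \<notin> {1..num H 1} \<longrightarrow> w t = 0)}"

definition W_tilde :: "('d::finite) hierarchy \<Rightarrow> nat \<Rightarrow> 'd field set" where
  "W_tilde H i = {w \<in> W_space H i.
     (\<forall>k\<in>cdofs H i. \<forall>s\<in>{1..num H i}. \<forall>s'\<in>{1..num H i}.
        relevant H i k s \<and> relevant H i k s' \<longrightarrow> cdof H i k s w = cdof H i k s' w) \<and>
     (\<forall>k\<in>cdofs H i. \<forall>s\<in>{1..num H i}.
        relevant H i k s \<and> on_boundary H i k \<longrightarrow> cdof H i k s w = 0)}"

definition W_Delta :: "('d::finite) hierarchy \<Rightarrow> nat \<Rightarrow> 'd field set" where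
  "W_Delta H i = {w \<in> W_space H i. \<forall>k\<in>cdofs H i. \<forall>s\<in>{1..num H i}.
     relevant H i k s \<longrightarrow> cdof H i k s w = 0}"

definition W_Pi :: "('d::finite) hierarchy \<Rightarrow> nat \<Rightarrow> 'd field set" where
  "W_Pi H i = min_energy H (W_tilde H i)
     (\<lambda>z w. \<forall>s\<in>{1..num H i}. same_cdofs_on H i s z w)"

definition U_space :: "('d::finite) hierarchy \<Rightarrow> nat \<Rightarrow> 'd field set" where
  "U_space H i =
     (if i \<le> 1
      then {w \<in> W_space H 1. \<forall>s\<in>{1..num H 1}. \<forall>s'\<in>{1..num H 1}. \<forall>x\<in>Om H 1 s \<inter> Om H 1 s'.
              w s x = w s' x}
      else W_Pi H (i - 1))"

definition U_I :: "('d::finite) hierarchy \<Rightarrow> nat \<Rightarrow> 'd field set" where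
  "U_I H i = {w \<in> U_space H i. \<forall>k\<in>Gamma H i. \<forall>s\<in>{1..num H i}. carries H i k s \<longrightarrow> dof H i k s w = 0}"

definition P_int :: "('d::finite) hierarchy \<Rightarrow> nat \<Rightarrow> 'd field \<Rightarrow> 'd field" where
  "P_int H i w = (THE p. p \<in> U_I H i \<and> (\<forall>z\<in>U_I H i. form H p z = form H w z))"

text \<open>
  The degrees of freedom of \<open>avg H i w\<close> on the interface are weighted averages of those of \<open>w\<close> on
  the substructures sharing them. The weights may couple degrees of freedom; the usual scalar
  weights are the case \<open>wt k s k' = 0\<close> for \<open>k \<noteq> k'\<close>.
\<close>

definition weighted_average :: "('d::finite) hierarchy \<Rightarrow> nat \<Rightarrow> bool" where
  "weighted_average H i \<longleftrightarrow>
     (\<exists>wt :: nat \<Rightarrow> nat \<Rightarrow> nat \<Rightarrow> real.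
        (\<forall>k\<in>Gamma H i. \<forall>k'\<in>Gamma H i.
           (\<Sum>s | s \<in> {1..num H i} \<and> carries H i k' s. wt k s k') = (if k = k' then 1 else 0)) \<and>
        (\<forall>w\<in>W_tilde H i. \<forall>k\<in>Gamma H i. \<forall>s\<in>{1..num H i}. carries H i k s \<longrightarrow>
           dof H i k s (avg H i w) =
             (\<Sum>k'\<in>Gamma H i. \<Sum>s' | s' \<in> {1..num H i} \<and> carries H i k' s'.
                wt k s' k' * dof H i k' s' w)))"

definition linear_projection_onto ::
  "'a::real_vector set \<Rightarrow> 'a set \<Rightarrow> ('a \<Rightarrow> 'a) \<Rightarrow> bool" where
  "linear_projection_onto V S E \<longleftrightarrow>
     linear_map_on V E \<and> S \<subseteq> V \<and> (\<forall>w\<in>V. E w \<in> S) \<and> (\<forall>u\<in>S. E u = u)"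

definition bddc_setting :: "('d::finite) hierarchy \<Rightarrow> bool" where
  "bddc_setting H \<longleftrightarrow>
     CARD('d) \<in> {2, 3} \<and>
     2 \<le> levels H \<and>
     open (region H) \<and> connected (region H) \<and> bounded (region H) \<and> region H \<noteq> {} \<and>
     conforming_mesh H \<and>
     posdef_on H (U_space H 1) \<and>
     (\<forall>i\<in>{1..<levels H}.
        agglomeration H i \<and>
        finite (cdofs H i) \<and>
        (\<forall>k\<in>cdofs H i. cloc H i k \<noteq> {} \<and> cloc H i k \<subseteq> node H ` {1..nnodes H}) \<and>
        (\<forall>k\<in>cdofs H i. \<forall>s\<in>{1..num H i}. relevant H i k s \<longrightarrow>
           linear_map_on (W_loc H i s) (cfun H i k s)) \<and>
        (2 \<le> i \<longrightarrow> Gamma_points H i \<subseteq> Gamma_points H (i - 1)) \<and>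
        posdef_on H (W_tilde H i) \<and>
        U_I H i \<subseteq> W_Delta H i \<and>
        linear_projection_onto (W_tilde H i) (U_space H i) (avg H i) \<and>
        weighted_average H i)"

text \<open>
  \<open>bddc_run H r u\<close>: the algorithm applied to \<open>r\<close> returns \<open>u\<close>. The sequences collect the
  quantities of all levels; the loops over the levels downwards and upwards are expressed by the
  relations between consecutive levels.
\<close>

definition bddc_run ::
  "('d::finite) hierarchy \<Rightarrow> ('d field \<Rightarrow> real) \<Rightarrow> 'd field \<Rightarrow> bool" where
  "bddc_run H r\<^sub>1 u\<^sub>1 \<longleftrightarrow>
     (\<exists>(r :: nat \<Rightarrow> 'd field \<Rightarrow> real) (r_B :: nat \<Rightarrow> 'd field \<Rightarrow> real)
        (u_I :: nat \<Rightarrow> 'd field) (w_Delta :: nat \<Rightarrow> 'd field)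
        (u_B :: nat \<Rightarrow> 'd field) (v_I :: nat \<Rightarrow> 'd field) (u :: nat \<Rightarrow> 'd field).
        r 1 = r\<^sub>1 \<and> u 1 = u\<^sub>1 \<and>
        (\<forall>i\<in>{1..<levels H}.
           r i \<in> dual (U_space H i) \<and>
           u_I i \<in> U_I H i \<and> (\<forall>z\<in>U_I H i. form H (u_I i) z = r i z) \<and>
           r_B i \<in> dual (U_space H i) \<and> (\<forall>v\<in>U_space H i. r_B i v = r i v - form H (u_I i) v) \<and>
           w_Delta i \<in> W_Delta H i \<and>
           (\<forall>z\<in>W_Delta H i. form H (w_Delta i) z = r_B i (avg H i z)) \<and>
           (if i = levels H - 1
            then u (i + 1) \<in> W_Pi H i \<and>
                 (\<forall>z\<in>W_Pi H i. form H (u (i + 1)) z = r_B i (avg H i z))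
            else r (i + 1) \<in> dual (U_space H (i + 1)) \<and>
                 (\<forall>z\<in>U_space H (i + 1). r (i + 1) z = r_B i (avg H i z))) \<and>
           u_B i = avg H i (w_Delta i + u (i + 1)) \<and>
           v_I i \<in> U_I H i \<and> (\<forall>z\<in>U_I H i. form H (v_I i) z = form H (u_B i) z) \<and>
           u i = u_I i + u_B i - v_I i))"

definition bddc :: "('d::finite) hierarchy \<Rightarrow> ('d field \<Rightarrow> real) \<Rightarrow> 'd field" where
  "bddc H r = (THE u. bddc_run H r u)"

definition A_op :: "('d::finite) hierarchy \<Rightarrow> 'd field \<Rightarrow> 'd field \<Rightarrow> real" where
  "A_op H u = restrict (form H u) (U_space H 1)"

definition BA_eigenvalues :: "('d::finite) hierarchy \<Rightarrow> real set" where
  "BA_eigenvalues H = eigenvalues_on (U_space H 1) (\<lambda>u. bddc H (A_op H u))"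

end

theory Submission
  imports Defs
begin

text \<open>
  The argument compares two functionals of a residual \<open>r\<close> on \<open>U\<^sub>i\<close>: the number \<open>r (B\<^sub>i r)\<close>, where
  \<open>B\<^sub>i\<close> is the preconditioner started at level \<open>i\<close>, and \<open>r (A\<^sub>i\<inverse> r)\<close>, the energy of the exact solution.
  Descending induction on the level shows that
  \<open>r (A\<^sub>i\<inverse> r) \<le> r (B\<^sub>i r) \<le> \<omega>\<^sub>i \<cdots> \<omega>\<^bsub>L-1\<^esub> \<cdot> r (A\<^sub>i\<inverse> r)\<close> (lemma \<open>precond_bounds\<close>); the solve on the
  coarsest level is exact, so the induction starts with equality.

  In the step, the interior correction splits off a common term \<open>e \<ge> 0\<close> from both numbers, and
  \<open>r (A\<^sub>i\<inverse> r) = e + \<parallel>b\<parallel>\<^sup>2\<close> with \<open>b\<close> the part of the exact solution orthogonal to the interior functions.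
  Let \<open>w\<close> solve \<open>a(w, z) = a(b, E\<^sub>i z)\<close> on the space \<open>W_tilde\<close>. It is the sum of the solutions on \<open>W_Delta\<close>
  and on its orthogonal complement \<open>W_Pi\<close>, and an exact coarse solve would give \<open>r (B\<^sub>i r) = e + \<parallel>w\<parallel>\<^sup>2\<close>.
  Two expansions of a square compare \<open>w\<close> with \<open>b\<close> (lemma \<open>two_level_bounds\<close>). Testing with \<open>b\<close>, which
  \<open>E\<^sub>i\<close> fixes, gives \<open>a(w, b) = \<parallel>b\<parallel>\<^sup>2\<close>, hence \<open>\<parallel>b\<parallel>\<^sup>2 \<le> \<parallel>w\<parallel>\<^sup>2\<close>. Testing with \<open>w\<close> gives
  \<open>\<parallel>w\<parallel>\<^sup>2 = a(b, (I - P\<^sub>i) E\<^sub>i w)\<close>, and the hypothesis on \<open>(I - P\<^sub>i) E\<^sub>i\<close> yields \<open>\<parallel>w\<parallel>\<^sup>2 \<le> \<omega>\<^sub>i \<parallel>b\<parallel>\<^sup>2\<close>.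
  Replacing the exact coarse solve by \<open>B\<^bsub>i+1\<^esub>\<close> costs the factor of the induction hypothesis.

  The same decomposition shows that \<open>B\<^sub>i\<close> is symmetric (lemma \<open>precond_sym\<close>). Hence \<open>B A\<close> is self-adjoint
  for the energy form, has a real eigenvalue, has only finitely many of them, and all lie between 1
  and the product of the \<open>\<omega>\<^sub>i\<close>.

  This argument needs only finite-dimensional spaces with a positive semidefinite form, and it is
  carried out in that generality. To apply it, the concrete spaces have to be shown to be such. The
  energy is an integral of gradients, so bilinearity requires that gradients of shape functions exist
  almost everywhere and have integrable products. The spaces of the higher levels are defined by energy
  minimization; they are subspaces because minimality is orthogonality to the functions with
  vanishing coarse degrees of freedom.
\<close>

section \<open>Gradients of the finite element shape functions\<close>

text \<open>
  The function \<open>grad\<close> is total and arbitrary where \<open>v\<close> is not differentiable, so a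
  gradient is only controlled on a set \<open>G\<close> of almost all points of an element \<open>K\<close>. Agreement on \<open>G\<close>
  with a function continuous on all of the compact set \<open>K\<close> gives boundedness up to the boundary and
  measurability at once, and with them the integrability of products.
\<close>

definition regular_gradient ::
  "(real ^ 'd) set \<Rightarrow> (real ^ 'd) set \<Rightarrow> (real ^ 'd::finite \<Rightarrow> real) \<Rightarrow> bool" where
  "regular_gradient K G v \<longleftrightarrow>
     (\<forall>x\<in>G. v differentiable (at x)) \<and> (\<exists>\<psi>. continuous_on K \<psi> \<and> (\<forall>x\<in>G. grad v x = \<psi> x))"

lemma grad_eqI:
  assumes "(v has_derivative v') (at x)"
  shows "grad v x = (\<chi> j. v' (axis j 1))"
  using frechet_derivative_at[OF assms] by (simp add: grad_def)

lemma grad_add: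
  assumes "u differentiable (at x)" "v differentiable (at x)"
  shows "grad (u + v) x = grad u x + grad v x"
proof -
  have "((\<lambda>y. u y + v y) has_derivative
      (\<lambda>h. frechet_derivative u (at x) h + frechet_derivative v (at x) h)) (at x)"
    using assms by (intro has_derivative_add) (auto simp: frechet_derivative_works)
  from grad_eqI[OF this] show ?thesis
    by (simp add: plus_fun_def) (simp add: grad_def vec_eq_iff)
qed

lemma grad_scaleR:
  assumes "u differentiable (at x)"
  shows "grad (c *\<^sub>R u) x = c *\<^sub>R grad u x"
proof -
  have "((\<lambda>y. c *\<^sub>R u y) has_derivative (\<lambda>h. c *\<^sub>R frechet_derivative u (at x) h)) (at x)"
    using assms by (intro has_derivative_scaleR_right) (auto simp: frechet_derivative_works)
  from grad_eqI[OF this] show ?thesis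
    by (simp add: scaleR_fun_def) (simp add: grad_def vec_eq_iff)
qed

lemma continuous_imp_absolutely_integrable_compact:
  fixes f :: "'a::euclidean_space \<Rightarrow> real"
  assumes "compact K" "continuous_on K f"
  shows "f absolutely_integrable_on K"
proof -
  have "integrable lborel (\<lambda>x. indicator K x *\<^sub>R f x)"
    using borel_integrable_compact[OF assms] .
  then show ?thesis
    unfolding set_integrable_def
    by (subst integrable_completion) (auto dest: borel_measurable_integrable)
qed

lemma grad_inner_absolutely_integrable:
  assumes "compact K" "negligible (K - G)" "regular_gradient K G u" "regular_gradient K G v"
  shows "(\<lambda>x. grad u x \<bullet> grad v x) absolutely_integrable_on K"
proof -
  obtain \<phi> \<psi> where "continuous_on K \<phi>" "\<forall>x\<in>G. grad u x = \<phi> x"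
    and "continuous_on K \<psi>" "\<forall>x\<in>G. grad v x = \<psi> x"
    using assms(3,4) by (auto simp: regular_gradient_def)
  moreover from this have "(\<lambda>x. \<phi> x \<bullet> \<psi> x) absolutely_integrable_on K"
    by (intro continuous_imp_absolutely_integrable_compact assms continuous_intros)
  ultimately show ?thesis
    by (elim absolutely_integrable_spike[OF _ assms(2)]) auto
qed

text \<open>
  A shape function is affine on the simplex, hence differentiable in the interior with constant
  gradient; the boundary of a convex set is negligible.
\<close>

lemma P1_regular_gradient:
  fixes e :: "('d::finite) fe"
  assumes "P1_element e"
  shows "compact (cell e)" "negligible (cell e - interior (cell e))"
    and "v \<in> shapes e \<Longrightarrow> regular_gradient (cell e) (interior (cell e)) v"
proof -
  have cell: "cell e = convex hull (nodes e)" and fin: "finite (nodes e)"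
    using assms by (auto simp: P1_element_def)
  show "compact (cell e)"
    unfolding cell by (intro finite_imp_compact_convex_hull fin)
  have "negligible (frontier (cell e))"
    unfolding cell by (intro negligible_convex_frontier convex_convex_hull)
  then show "negligible (cell e - interior (cell e))"
    by (rule negligible_subset) (auto simp: frontier_def closure_def)
  assume "v \<in> shapes e"
  then obtain c b where v: "v x = c \<bullet> x + b" if "x \<in> cell e" for x
    using assms by (auto simp: P1_element_def)
  have der: "(v has_derivative (\<lambda>h. c \<bullet> h)) (at x)" if x: "x \<in> interior (cell e)" for x
  proof (rule has_derivative_transform_within_open[OF _ open_interior x])
    show "((\<lambda>x. c \<bullet> x + b) has_derivative (\<lambda>h. c \<bullet> h)) (at x)"
      by (auto intro!: derivative_eq_intros)
    show "c \<bullet> y + b = v y" if "y \<in> interior (cell e)" for y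
      using v that interior_subset by force
  qed
  have "grad v x = c" if "x \<in> interior (cell e)" for x
    using grad_eqI[OF der[OF that]] by (simp add: inner_axis vec_eq_iff)
  then show "regular_gradient (cell e) (interior (cell e)) v"
    using der unfolding regular_gradient_def
    by (intro conjI ballI exI[of _ "\<lambda>x. c"]) (auto simp: differentiable_def)
qed

lemma Q1_elementE:
  fixes e :: "('d::finite) fe"
  assumes "Q1_element e"
  obtains F :: "real ^ 'd \<Rightarrow> real ^ 'd" where
    "\<forall>j. (\<lambda>x. F x $ j) \<in> Q1_poly" "inj_on F (cbox 0 1)"
    "\<forall>x\<in>cbox 0 1. det (matrix (frechet_derivative F (at x))) \<noteq> 0"
    "cell e = F ` cbox 0 1"
    "nodes e = F ` {x. \<forall>j. x $ j \<in> {0, 1}}"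
    "shapes e = {v. \<exists>q\<in>Q1_poly. \<forall>x\<in>cbox 0 1. v (F x) = q x}"
  using assms unfolding Q1_element_def
  by (elim exE conjE) (rule that; assumption)

text \<open>
  The derivative at \<open>x\<close> in direction \<open>h\<close> of the multilinear polynomial with coefficients \<open>c\<close>, by the product
  rule.
\<close>

definition Q1_grad :: "('d::finite set \<Rightarrow> real) \<Rightarrow> real ^ 'd \<Rightarrow> real ^ 'd \<Rightarrow> real" where
  "Q1_grad c x h = (\<Sum>S\<in>UNIV. c S * (\<Sum>i\<in>S. h $ i * (\<Prod>j\<in>S - {i}. x $ j)))"

lemma Q1_has_derivative:
  assumes "\<forall>x. q x = (\<Sum>S\<in>UNIV. c S * (\<Prod>j\<in>S. x $ j))"
  shows "(q has_derivative Q1_grad c x) (at x)"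
proof -
  have "q = (\<lambda>x. \<Sum>S\<in>UNIV. c S * (\<Prod>j\<in>S. x $ j))"
    using assms by blast
  then show ?thesis
    unfolding Q1_grad_def
    by (auto intro!: has_derivative_sum has_derivative_mult_right has_derivative_prod
        bounded_linear.has_derivative[OF bounded_linear_vec_nth] has_derivative_ident)
qed

lemma continuous_on_Q1_grad:
  assumes "continuous_on A f" "continuous_on A g"
  shows "continuous_on A (\<lambda>x. Q1_grad c (f x) (g x))"
  unfolding Q1_grad_def by (intro continuous_intros assms)

lemma continuous_on_det:
  fixes M :: "'a::topological_space \<Rightarrow> real ^ 'd::finite ^ 'd"
  assumes "\<And>i j. continuous_on A (\<lambda>x. M x $ i $ j)"
  shows "continuous_on A (\<lambda>x. det (M x))"
  unfolding det_def by (intro continuous_intros assms)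

text \<open>
  On the image \<open>G\<close> of the open unit cube, a shape function is \<open>q \<circ> F\<inverse>\<close> with a polynomial \<open>q\<close>. The set \<open>G\<close>
  is open by invariance of domain, and \<open>F\<inverse>\<close> is differentiable there by the inverse function theorem.
  The chain rule expresses the gradient through the inverse Jacobian of \<open>F\<close>, which depends
  continuously on the point up to the boundary of the cube because the determinant is nonzero there
  too. The rest of the cell is the image of the boundary of the cube under a differentiable map and
  so is negligible.
\<close>

lemma Q1_regular_gradient:
  fixes e :: "('d::finite) fe"
  assumes "Q1_element e"
  shows "\<exists>G. compact (cell e) \<and> negligible (cell e - G) \<and>
    (\<forall>v\<in>shapes e. regular_gradient (cell e) G v)"
proof -
  obtain F :: "real ^ 'd \<Rightarrow> real ^ 'd" where
    Q: "\<forall>j. (\<lambda>x. F x $ j) \<in> Q1_poly" and inj: "inj_on F (cbox 0 1)"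
    and det: "\<forall>x\<in>cbox 0 1. det (matrix (frechet_derivative F (at x))) \<noteq> 0"
    and cell: "cell e = F ` cbox 0 1"
    and shapes: "shapes e = {v. \<exists>q\<in>Q1_poly. \<forall>x\<in>cbox 0 1. v (F x) = q x}"
    by (rule Q1_elementE[OF assms]) (rule that; assumption)
  have "\<forall>j. \<exists>c. \<forall>x. F x $ j = (\<Sum>S\<in>UNIV. c S * (\<Prod>k\<in>S. x $ k))"
    using Q unfolding Q1_poly_def by simp
  from choice[OF this] have "\<exists>c. \<forall>j x. F x $ j = (\<Sum>S\<in>UNIV. c j S * (\<Prod>k\<in>S. x $ k))" .
  then obtain c where c: "\<And>j. \<forall>x. F x $ j = (\<Sum>S\<in>UNIV. c j S * (\<Prod>k\<in>S. x $ k))"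
    by blast
  define F' where "F' = (\<lambda>x h. \<chi> j. Q1_grad (c j) x h)"
  have derF: "(F has_derivative F' x) (at x)" for x
    unfolding has_derivative_componentwise_within[of F] F'_def
    by (auto simp: Basis_vec_def inner_axis Q1_has_derivative[OF c])
  then have diffF: "F differentiable_on S" for S
    by (meson differentiable_at_imp_differentiable_on differentiableI)
  then have contF: "continuous_on S F" for S
    by (rule differentiable_imp_continuous_on)
  define M where "M x = matrix (F' x)" for x
  have MF': "M x *v h = F' x h" for x h
    unfolding M_def using has_derivative_linear[OF derF, of x]
    by (intro matrix_works) (simp add: linear_matrix_vector_mul_eq)
  have detM: "det (M x) \<noteq> 0" if "x \<in> cbox 0 1" for x
    using det[rule_format, OF that] frechet_derivative_at[OF derF, of x] by (simp add: M_def)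
  have contM: "continuous_on A (\<lambda>x. M x $ i $ j)" for A i j
    unfolding M_def matrix_def F'_def by (simp, intro continuous_on_Q1_grad continuous_intros)
  \<comment> \<open>By Cramer's rule, the inverse of the Jacobian matrix depends continuously on the point.\<close>
  define G' where "G' x b = (\<chi> k. det (\<chi> i j. if j = k then b $ i else M x $ i $ j) / det (M x))"
    for x and b :: "real ^ 'd"
  have F'G': "F' x (G' x b) = b" if "x \<in> cbox 0 1" for x b
    using cramer[OF detM[OF that], of "G' x b" b] by (simp add: MF' G'_def)
  have contG': "continuous_on (cbox 0 1) (\<lambda>x. G' x b)" for b
    unfolding G'_def
  proof (intro continuous_on_vec_lambda continuous_on_divide continuous_on_det contM ballI detM)
    show "continuous_on (cbox 0 1) (\<lambda>x. (\<chi> i j. if j = k then b $ i else M x $ i $ j) $ i $ j)"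
      for k i j
      by (cases "j = k") (auto simp: contM)
  qed auto
  define K and G where "K = cell e" and "G = F ` box 0 1"
  define inv where "inv = the_inv_into (cbox 0 1) F"
  have inv: "inv (F x) = x" if "x \<in> cbox 0 1" for x
    unfolding inv_def by (rule the_inv_into_f_f[OF inj that])
  have continv: "continuous_on K inv"
    unfolding K_def cell by (rule continuous_on_inv[OF contF compact_cbox]) (simp add: inv)
  have "compact K"
    unfolding K_def cell by (intro compact_continuous_image contF compact_cbox)
  moreover have "negligible (K - G)"
  proof (rule negligible_subset)
    show "negligible (F ` (cbox 0 1 - box 0 1))"
      by (rule negligible_differentiable_image_negligible)
        (auto simp: diffF negligible_frontier_interval)
    show "K - G \<subseteq> F ` (cbox 0 1 - box 0 1)"
      by (auto simp: K_def G_def cell)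
  qed
  moreover have "regular_gradient K G v" if v: "v \<in> shapes e" for v
  proof -
    obtain q where "q \<in> Q1_poly" and vq: "\<forall>x\<in>cbox 0 1. v (F x) = q x"
      using v unfolding shapes by blast
    then obtain b where b: "\<forall>x. q x = (\<Sum>S\<in>UNIV. b S * (\<Prod>j\<in>S. x $ j))"
      unfolding Q1_poly_def by auto
    have openG: "open G"
      unfolding G_def
      by (intro invariance_of_domain contF open_box inj_on_subset[OF inj] box_subset_cbox)
    have der: "(v has_derivative (\<lambda>h. Q1_grad b x (G' x h))) (at (F x))" if x: "x \<in> box 0 1" for x
    proof -
      have x': "x \<in> cbox 0 1" using x box_subset_cbox by blast
      have "(inv has_derivative G' x) (at (F x))"
      proof (rule has_derivative_inverse_strong[OF open_box x contF _ derF])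
        show "inv (F y) = y" if "y \<in> box 0 1" for y
          using that box_subset_cbox by (intro inv) blast
        show "F' x \<circ> G' x = id"
          using F'G'[OF x'] by auto
      qed
      moreover have "(q has_derivative Q1_grad b x) (at (inv (F x)))"
        using Q1_has_derivative[OF b] by (simp add: inv x')
      ultimately have "((\<lambda>y. q (inv y)) has_derivative (\<lambda>h. Q1_grad b x (G' x h))) (at (F x))"
        by (rule has_derivative_compose)
      then show ?thesis
      proof (rule has_derivative_transform_within_open[OF _ openG])
        show "F x \<in> G" using x by (simp add: G_def)
        fix y assume "y \<in> G"
        then obtain z where "z \<in> cbox 0 1" "y = F z"
          using box_subset_cbox unfolding G_def by blast
        then show "q (inv y) = v y" using vq inv by simp
      qed
    qed
    define \<psi> where "\<psi> y = (\<chi> j. Q1_grad b (inv y) (G' (inv y) (axis j 1)))" for y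
    have "continuous_on K \<psi>"
      unfolding \<psi>_def
    proof (intro continuous_on_vec_lambda continuous_on_Q1_grad continv)
      have "inv ` K \<subseteq> cbox 0 1" by (auto simp: K_def cell inv)
      then show "continuous_on K (\<lambda>y. G' (inv y) (axis j 1))" for j
        by (rule continuous_on_compose2[OF contG' continv])
    qed
    moreover have "v differentiable (at y) \<and> grad v y = \<psi> y" if y: "y \<in> G" for y
    proof -
      obtain x where x: "x \<in> box 0 1" "y = F x" using y by (auto simp: G_def)
      then have "x \<in> cbox 0 1" using box_subset_cbox by blast
      then show ?thesis
        using der[OF x(1)] by (auto simp: x \<psi>_def inv grad_eqI differentiable_def)
    qed
    ultimately show ?thesis by (auto simp: regular_gradient_def)
  qed
  ultimately show ?thesis unfolding K_def by blast
qed

lemma element_regular_gradient: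
  assumes "P1_element e \<or> Q1_element e"
  shows "\<exists>G. compact (cell e) \<and> negligible (cell e - G) \<and>
    (\<forall>v\<in>shapes e. regular_gradient (cell e) G v)"
  using assms P1_regular_gradient[of e] Q1_regular_gradient[of e] by blast

lemma subspace_shapes:
  fixes e :: "('d::finite) fe"
  assumes "P1_element e \<or> Q1_element e"
  shows "subspace (shapes e)"
proof (rule disjE[OF assms])
  assume "P1_element e"
  then have e: "shapes e = {v. \<exists>c b. \<forall>x\<in>cell e. v x = c \<bullet> x + b}"
    by (simp add: P1_element_def)
  show ?thesis
    unfolding e
  proof (rule subspaceI; clarify)
    show "\<exists>c b. \<forall>x\<in>cell e. (0 :: real ^ 'd \<Rightarrow> real) x = c \<bullet> x + b"
      by (intro exI[of _ 0]) auto
    fix u v :: "real ^ 'd \<Rightarrow> real" and c b c' b'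
    assume "\<forall>x\<in>cell e. u x = c \<bullet> x + b" "\<forall>x\<in>cell e. v x = c' \<bullet> x + b'"
    then show "\<exists>c b. \<forall>x\<in>cell e. (u + v) x = c \<bullet> x + b"
      by (intro exI[of _ "c + c'"] exI[of _ "b + b'"]) (auto simp: inner_add_left)
  next
    fix u :: "real ^ 'd \<Rightarrow> real" and c b k
    assume "\<forall>x\<in>cell e. u x = c \<bullet> x + b"
    then show "\<exists>c b. \<forall>x\<in>cell e. (k *\<^sub>R u) x = c \<bullet> x + b"
      by (intro exI[of _ "k *\<^sub>R c"] exI[of _ "k * b"]) (auto simp: scaleR_fun_def algebra_simps)
  qed
next
  assume "Q1_element e"
  then obtain F :: "real ^ 'd \<Rightarrow> real ^ 'd" where
    e: "shapes e = {v. \<exists>q\<in>Q1_poly. \<forall>x\<in>cbox 0 1. v (F x) = q x}"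
    by (rule Q1_elementE) (rule that; assumption)
  have Q0: "(\<lambda>x. 0) \<in> (Q1_poly :: (real ^ 'd \<Rightarrow> real) set)"
    unfolding Q1_poly_def by (auto intro!: exI[of _ "\<lambda>S. 0"])
  have Qadd: "(\<lambda>x. p x + q x) \<in> Q1_poly" if "p \<in> Q1_poly" "q \<in> Q1_poly" for p q :: "real ^ 'd \<Rightarrow> real"
  proof -
    obtain c c' where "\<forall>x. p x = (\<Sum>S\<in>UNIV. c S * (\<Prod>j\<in>S. x $ j))"
      "\<forall>x. q x = (\<Sum>S\<in>UNIV. c' S * (\<Prod>j\<in>S. x $ j))"
      using \<open>p \<in> Q1_poly\<close> \<open>q \<in> Q1_poly\<close> unfolding Q1_poly_def by blast
    then show ?thesis
      unfolding Q1_poly_def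
      by (auto intro!: exI[of _ "\<lambda>S. c S + c' S"] simp: distrib_right sum.distrib)
  qed
  have Qscale: "(\<lambda>x. k * p x) \<in> Q1_poly" if "p \<in> Q1_poly" for k and p :: "real ^ 'd \<Rightarrow> real"
  proof -
    obtain c where "\<forall>x. p x = (\<Sum>S\<in>UNIV. c S * (\<Prod>j\<in>S. x $ j))"
      using \<open>p \<in> Q1_poly\<close> unfolding Q1_poly_def by blast
    then show ?thesis
      unfolding Q1_poly_def
      by (auto intro!: exI[of _ "\<lambda>S. k * c S"] simp: sum_distrib_left mult.assoc)
  qed
  show ?thesis
    unfolding e
  proof (rule subspaceI; clarify)
    show "\<exists>q\<in>Q1_poly. \<forall>x\<in>cbox 0 1. (0 :: real ^ 'd \<Rightarrow> real) (F x) = q x"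
      using Q0 by (intro bexI) auto
  next
    fix u v p q :: "real ^ 'd \<Rightarrow> real"
    assume "p \<in> Q1_poly" "\<forall>x\<in>cbox 0 1. u (F x) = p x" "q \<in> Q1_poly" "\<forall>x\<in>cbox 0 1. v (F x) = q x"
    then show "\<exists>q\<in>Q1_poly. \<forall>x\<in>cbox 0 1. (u + v) (F x) = q x"
      by (intro bexI[OF _ Qadd[of p q]]) auto
  next
    fix u p :: "real ^ 'd \<Rightarrow> real" and k
    assume "p \<in> Q1_poly" "\<forall>x\<in>cbox 0 1. u (F x) = p x"
    then show "\<exists>q\<in>Q1_poly. \<forall>x\<in>cbox 0 1. (k *\<^sub>R u) (F x) = q x"
      by (intro bexI[OF _ Qscale[of p k]]) (auto simp: scaleR_fun_def)
  qed
qed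

lemma finite_nodes:
  assumes "P1_element e \<or> Q1_element e"
  shows "finite (nodes e)"
proof -
  have "finite {x :: real ^ 'd::finite. \<forall>j. x $ j \<in> {0, 1}}"
  proof (rule finite_subset)
    show "{x :: real ^ 'd. \<forall>j. x $ j \<in> {0, 1}} \<subseteq> range (\<lambda>T. \<chi> j. if j \<in> T then 1 else 0)"
    proof
      fix x :: "real ^ 'd" assume "x \<in> {x. \<forall>j. x $ j \<in> {0, 1}}"
      then have "x = (\<chi> j. if j \<in> {j. x $ j = 1} then 1 else 0)"
        by (auto simp: vec_eq_iff)
      then show "x \<in> range (\<lambda>T. \<chi> j. if j \<in> T then 1 else 0)" by blast
    qed
  qed auto
  then show ?thesis
    using assms by (auto simp: P1_element_def elim!: Q1_elementE)
qed

text \<open>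
  The value at the vertex that is the indicator vector of \<open>T\<close> is the sum of the coefficients of all
  \<open>S \<subseteq> T\<close>; induction on the size of \<open>T\<close> shows that every coefficient vanishes.
\<close>

lemma Q1_poly_zero_at_vertices:
  fixes q :: "real ^ 'd::finite \<Rightarrow> real"
  assumes "q \<in> Q1_poly" and zero: "\<And>x. \<forall>j. x $ j \<in> {0, 1} \<Longrightarrow> q x = 0"
  shows "q x = 0"
proof -
  obtain c where c: "\<And>x. q x = (\<Sum>S\<in>UNIV. c S * (\<Prod>j\<in>S. x $ j))"
    using assms(1) by (auto simp: Q1_poly_def)
  have "c T = 0" for T
  proof (induction "card T" arbitrary: T rule: less_induct)
    case less
    let ?x = "\<chi> j. if j \<in> T then 1 else (0::real)"
    have "0 = q ?x" by (subst zero) auto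
    also have "\<dots> = (\<Sum>S\<in>UNIV. if S = T then c T else 0)"
      unfolding c
    proof (rule sum.cong[OF refl])
      fix S :: "'d set"
      consider "S = T" | "S \<subset> T" | j where "j \<in> S" "j \<notin> T" by blast
      then show "c S * (\<Prod>j\<in>S. ?x $ j) = (if S = T then c T else 0)"
      proof cases
        case 2
        then have "card S < card T" by (intro psubset_card_mono) auto
        with less 2 show ?thesis by auto
      qed (auto intro!: prod.neutral)
    qed
    also have "\<dots> = c T" by simp
    finally show ?case by simp
  qed
  then show ?thesis by (simp add: c)
qed

lemma shape_zero_at_nodes:
  fixes e :: "('d::finite) fe"
  assumes e: "P1_element e \<or> Q1_element e" and v: "v \<in> shapes e"
    and zero: "\<And>x. x \<in> nodes e \<Longrightarrow> v x = 0" and x: "x \<in> cell e"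
  shows "v x = 0"
proof (rule disjE[OF e])
  assume "P1_element e"
  then obtain c b where cell: "cell e = convex hull (nodes e)"
    and vb: "\<forall>x\<in>cell e. v x = c \<bullet> x + b"
    using v by (auto simp: P1_element_def)
  have "convex hull (nodes e) \<subseteq> {x. c \<bullet> x = - b}"
  proof (rule hull_minimal)
    show "convex {x. c \<bullet> x = - b}" by (rule convex_hyperplane)
    show "nodes e \<subseteq> {x. c \<bullet> x = - b}"
      using zero vb hull_subset[of "nodes e" convex] unfolding cell by fastforce
  qed
  then show ?thesis using x vb by (auto simp: cell)
next
  assume "Q1_element e"
  then obtain F :: "real ^ 'd \<Rightarrow> real ^ 'd" where
    F: "cell e = F ` cbox 0 1" "nodes e = F ` {x. \<forall>j. x $ j \<in> {0, 1}}"
    and shapes: "shapes e = {v. \<exists>q\<in>Q1_poly. \<forall>x\<in>cbox 0 1. v (F x) = q x}"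
    by (rule Q1_elementE) (rule that; assumption)
  obtain q where q: "q \<in> Q1_poly" "\<forall>x\<in>cbox 0 1. v (F x) = q x"
    using v unfolding shapes by auto
  have "q x = 0" if "\<forall>j. x $ j \<in> {0, 1}" for x
  proof -
    have "0 \<le> x $ j \<and> x $ j \<le> 1" for j
      using that[rule_format, of j] by auto
    then have "x \<in> cbox 0 1" by (auto simp: mem_box_cart)
    then show ?thesis using q zero F that by force
  qed
  then show ?thesis using Q1_poly_zero_at_vertices[OF q(1)] q(2) x F by auto
qed

section \<open>Energy forms on finite-dimensional spaces\<close>

definition fin_dim :: "'a::real_vector set \<Rightarrow> bool" where
  "fin_dim V \<longleftrightarrow> (\<exists>B. finite B \<and> V \<subseteq> span B)"

lemma fin_dim_basis:
  assumes "fin_dim V" "subspace V"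
  obtains B where "finite B" "V = span B"
proof -
  obtain C where C: "finite C" "V \<subseteq> span C" using assms(1) by (auto simp: fin_dim_def)
  obtain B where B: "B \<subseteq> V" "independent B" "V \<subseteq> span B"
    using maximal_independent_subset[of V] by auto
  have "finite B" using independent_span_bound[OF C(1) B(2)] B(1) C(2) by auto
  moreover have "V = span B" using B span_minimal[OF B(1) assms(2)] by auto
  ultimately show thesis by (rule that)
qed

lemma fin_dim_subset: "fin_dim V \<Longrightarrow> W \<subseteq> V \<Longrightarrow> fin_dim W"
  unfolding fin_dim_def by blast

text \<open>
  Finitely many functionals that separate the points of \<open>V\<close> bound its dimension: passing to the
  kernel of one functional lowers the dimension by at most one, and no functional is left when \<open>V\<close> is
  zero. It serves to avoid writing down a basis of the finite element functions; nodal values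
  separate them.
\<close>

lemma fin_dim_if_separated:
  fixes f :: "'i \<Rightarrow> 'a::real_vector \<Rightarrow> real"
  assumes "finite X" "subspace V" "\<And>i. i \<in> X \<Longrightarrow> linear_map_on V (f i)"
    and "\<And>v. v \<in> V \<Longrightarrow> (\<And>i. i \<in> X \<Longrightarrow> f i v = 0) \<Longrightarrow> v = 0"
  shows "fin_dim V"
  using assms
proof (induction X arbitrary: V rule: finite_induct)
  case empty
  then have "V \<subseteq> span {}" by auto
  then show ?case unfolding fin_dim_def by blast
next
  case (insert i X)
  let ?V = "{v \<in> V. f i v = 0}"
  have lin: "linear_map_on V (f i)" using insert.prems by auto
  then have add: "f i (x + y) = f i x + f i y" and scale: "f i (c *\<^sub>R x) = c * f i x"
    if "x \<in> V" "y \<in> V" for x y c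
    using that by (auto simp: linear_map_on_def)
  have zero: "f i 0 = 0"
    using scale[OF subspace_0 subspace_0, OF insert.prems(1) insert.prems(1), of 0] by simp
  have "fin_dim ?V"
  proof (rule insert.IH)
    show "subspace ?V"
      using insert.prems(1) by (intro subspaceI) (auto simp: zero add scale subspace_0 subspace_add subspace_scale)
    show "linear_map_on ?V (f j)" if "j \<in> X" for j
      using insert.prems(2)[of j] that by (auto simp: linear_map_on_def)
    show "v = 0" if "v \<in> ?V" "\<And>j. j \<in> X \<Longrightarrow> f j v = 0" for v
      using insert.prems(3)[of v] that by auto
  qed
  then obtain B where B: "finite B" "?V \<subseteq> span B" by (auto simp: fin_dim_def)
  show ?case
  proof (cases "\<exists>b\<in>V. f i b \<noteq> 0")
    case False
    then have "?V = V" by auto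
    with \<open>fin_dim ?V\<close> show ?thesis by simp
  next
    case True
    then obtain b where b: "b \<in> V" "f i b \<noteq> 0" by blast
    have "v \<in> span (insert b B)" if v: "v \<in> V" for v
    proof -
      define k where "k = f i v / f i b"
      have "v + (- k) *\<^sub>R b \<in> ?V"
        using v b insert.prems(1)
        by (auto simp: add scale subspace_scale subspace_add k_def simp del: scaleR_minus_left)
      then have "v + (- k) *\<^sub>R b \<in> span B" using B by blast
      then show ?thesis unfolding span_insert by auto
    qed
    then show ?thesis using B(1) unfolding fin_dim_def by (intro exI[of _ "insert b B"]) auto
  qed
qed

text \<open>
  The form is only required to behave on \<open>V\<close>, since the energy integral is not bilinear on arbitrary
  functions. It is only semidefinite on \<open>V\<close>, as a function that is constant on a substructure away from the
  boundary of the region has zero energy there; definiteness is a property of the subspaces in which problems are solved.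
\<close>

locale energy_form =
  fixes V :: "'a::real_vector set" and a :: "'a \<Rightarrow> 'a \<Rightarrow> real"
  assumes subspace_V: "subspace V"
    and fin_dim_V: "fin_dim V"
    and form_add: "x \<in> V \<Longrightarrow> y \<in> V \<Longrightarrow> z \<in> V \<Longrightarrow> a (x + y) z = a x z + a y z"
    and form_scale: "x \<in> V \<Longrightarrow> z \<in> V \<Longrightarrow> a (c *\<^sub>R x) z = c * a x z"
    and form_sym: "x \<in> V \<Longrightarrow> y \<in> V \<Longrightarrow> a x y = a y x"
    and form_nonneg: "x \<in> V \<Longrightarrow> 0 \<le> a x x"
begin

lemma V_closed [simp]:
  "0 \<in> V" "x \<in> V \<Longrightarrow> y \<in> V \<Longrightarrow> x + y \<in> V" "x \<in> V \<Longrightarrow> y \<in> V \<Longrightarrow> x - y \<in> V"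
  "x \<in> V \<Longrightarrow> c *\<^sub>R x \<in> V"
  using subspace_V by (auto intro: subspace_0 subspace_add subspace_diff subspace_scale)

lemma form_add_right: "x \<in> V \<Longrightarrow> y \<in> V \<Longrightarrow> z \<in> V \<Longrightarrow> a z (x + y) = a z x + a z y"
  using form_add[of x y z] form_sym by simp

lemma form_scale_right: "x \<in> V \<Longrightarrow> z \<in> V \<Longrightarrow> a z (c *\<^sub>R x) = c * a z x"
  using form_scale[of x z c] form_sym by simp

lemma form_diff: "x \<in> V \<Longrightarrow> y \<in> V \<Longrightarrow> z \<in> V \<Longrightarrow> a (x - y) z = a x z - a y z"
  using form_add[of "x - y" y z] by simp

lemma form_diff_right: "x \<in> V \<Longrightarrow> y \<in> V \<Longrightarrow> z \<in> V \<Longrightarrow> a z (x - y) = a z x - a z y"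
  using form_diff[of x y z] form_sym by simp

lemma form_zero: "z \<in> V \<Longrightarrow> a 0 z = 0" "z \<in> V \<Longrightarrow> a z 0 = 0"
  using form_scale[of 0 z 0] form_sym[of 0 z] by auto

lemmas form_simps = form_add form_add_right form_diff form_diff_right form_scale form_scale_right
  form_zero

lemma energy_scale_add:
  assumes "x \<in> V" "y \<in> V"
  shows "a (x + t *\<^sub>R y) (x + t *\<^sub>R y) = a x x + 2 * t * a x y + t\<^sup>2 * a y y"
  using assms form_sym[of y x] by (simp add: form_simps power2_eq_square algebra_simps)

text \<open>
  The quadratic \<open>t \<mapsto> a(x + t y, x + t y)\<close> has its minimum at 0, so its linear coefficient vanishes.
\<close>

lemma stationary_at_minimum:
  assumes "x \<in> V" "y \<in> V" "\<And>t. a x x \<le> a (x + t *\<^sub>R y) (x + t *\<^sub>R y)"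
  shows "a x y = 0"
proof -
  define e where "e = a y y + 1"
  have e: "e > 0" using form_nonneg[OF assms(2)] by (simp add: e_def)
  \<comment> \<open>The minimizing parameter is \<open>- a x y / a y y\<close>; the added 1 keeps the denominator positive.\<close>
  have "0 \<le> 2 * (- a x y / e) * a x y + (- a x y / e)\<^sup>2 * (e - 1)"
    using assms(3)[of "- a x y / e"] unfolding energy_scale_add[OF assms(1,2)] by (simp add: e_def)
  also have "\<dots> = - ((a x y)\<^sup>2 * (e + 1)) / e\<^sup>2"
    using e by (simp add: field_simps power2_eq_square)
  finally have "(a x y)\<^sup>2 * (e + 1) \<le> 0"
    using e by (simp add: divide_le_0_iff zero_le_divide_iff)
  then have "(a x y)\<^sup>2 \<le> 0"
    using e by (simp add: mult_le_0_iff)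
  then show ?thesis
    by simp
qed

text \<open>
  The functions with the same degrees of freedom as \<open>w\<close> form the affine space \<open>w + K\<close>, on which minimal
  energy at \<open>w\<close> means orthogonality to \<open>K\<close>. The set of energy-minimal functions is a subspace by this
  characterization.
\<close>

lemma minimal_energy_iff_orthogonal:
  assumes S: "S \<subseteq> V" "subspace S" and K: "K \<subseteq> S" "subspace K"
    and same: "\<And>w z. w \<in> S \<Longrightarrow> z \<in> S \<Longrightarrow> same z w \<longleftrightarrow> z - w \<in> K"
    and w: "w \<in> S"
  shows "(\<forall>z\<in>S. same z w \<longrightarrow> a w w \<le> a z z) \<longleftrightarrow> (\<forall>k\<in>K. a w k = 0)"
proof
  assume min: "\<forall>z\<in>S. same z w \<longrightarrow> a w w \<le> a z z"
  show "\<forall>k\<in>K. a w k = 0"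
  proof
    fix k assume k: "k \<in> K"
    have "a w w \<le> a (w + t *\<^sub>R k) (w + t *\<^sub>R k)" for t
    proof -
      have "w + t *\<^sub>R k \<in> S" using w k K S by (auto intro: subspace_add subspace_scale)
      moreover have "same (w + t *\<^sub>R k) w"
        unfolding same[OF w calculation] using k K by (auto intro: subspace_scale)
      ultimately show ?thesis using min by blast
    qed
    then show "a w k = 0" using w k K S by (intro stationary_at_minimum) auto
  qed
next
  assume orth: "\<forall>k\<in>K. a w k = 0"
  show "\<forall>z\<in>S. same z w \<longrightarrow> a w w \<le> a z z"
  proof clarify
    fix z assume z: "z \<in> S" "same z w"
    have "z - w \<in> K" using same[OF w z(1)] z(2) by simp
    then have "a w (z - w) = 0" "z - w \<in> V" "z \<in> V" "w \<in> V" using orth K S w z by auto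
    then show "a w w \<le> a z z"
      using energy_scale_add[of w "z - w" 1] form_nonneg[of "z - w"] by simp
  qed
qed

lemma subspace_orthogonal:
  assumes "S \<subseteq> V" "subspace S" "K \<subseteq> V"
  shows "subspace {w \<in> S. \<forall>k\<in>K. a w k = 0}"
  using assms by (intro subspaceI)
    (auto simp: form_simps subset_iff subspace_0 subspace_add subspace_scale)

definition posdef :: "'a set \<Rightarrow> bool" where
  "posdef S \<longleftrightarrow> (\<forall>x\<in>S. x \<noteq> 0 \<longrightarrow> 0 < a x x)"

lemma posdef_subset: "posdef S \<Longrightarrow> T \<subseteq> S \<Longrightarrow> posdef T"
  unfolding posdef_def by blast

lemma posdef_zero: "posdef S \<Longrightarrow> x \<in> S \<Longrightarrow> a x x = 0 \<Longrightarrow> x = 0"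
  unfolding posdef_def by fastforce

lemma posdef_eqI:
  assumes "posdef S" "S \<subseteq> V" "subspace S" "x \<in> S" "y \<in> S" "\<And>z. z \<in> S \<Longrightarrow> a x z = a y z"
  shows "x = y"
proof -
  have d: "x - y \<in> S" using assms by (auto intro: subspace_diff)
  then have "a (x - y) (x - y) = 0"
    using assms subsetD[OF assms(2)] by (simp add: form_diff)
  then show ?thesis using posdef_zero[OF assms(1) d] by simp
qed

text \<open>
  One Gram-Schmidt step: \<open>p\<close> is the orthogonal projection of the new vector \<open>b\<close> onto the span of \<open>B\<close>.
\<close>

lemma split_off_orthogonal:
  assumes "span (insert b B) \<subseteq> V" and b: "b \<notin> span B"
    and p: "p \<in> span B" "\<forall>z\<in>span B. a p z = a b z"
  shows "b - p \<in> span (insert b B)" "b - p \<noteq> 0"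
    "\<And>z. z \<in> span B \<Longrightarrow> a (b - p) z = 0"
    "\<And>x. x \<in> span (insert b B) \<Longrightarrow> \<exists>k. \<exists>x'\<in>span B. x = x' + k *\<^sub>R (b - p)"
proof -
  have sub: "span B \<subseteq> span (insert b B)" by (intro span_mono) auto
  have bV: "b \<in> span (insert b B)" by (simp add: span_base)
  show "b - p \<in> span (insert b B)" using sub p(1) bV by (auto intro: span_diff)
  show "b - p \<noteq> 0" using b p(1) by auto
  show "a (b - p) z = 0" if "z \<in> span B" for z
    using that p assms(1) sub bV by (subst form_diff) auto
  fix x assume "x \<in> span (insert b B)"
  then obtain k where k: "x - k *\<^sub>R b \<in> span B" unfolding span_insert by auto
  have "x = (x - k *\<^sub>R b + k *\<^sub>R p) + k *\<^sub>R (b - p)" by (simp add: algebra_simps)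
  moreover have "x - k *\<^sub>R b + k *\<^sub>R p \<in> span B" using k p(1) by (intro span_add span_scale)
  ultimately show "\<exists>k. \<exists>x'\<in>span B. x = x' + k *\<^sub>R (b - p)" by blast
qed

text \<open>
  By induction on the spanning set: the solution on the enlarged space is the solution on the smaller
  one plus a multiple of a vector orthogonal to it. The orthogonal vector itself comes from the
  induction hypothesis, applied to the functional \<open>a b\<close>.
\<close>

lemma riesz_span:
  assumes "finite B" "span B \<subseteq> V" "posdef (span B)" "linear_map_on (span B) r"
  shows "\<exists>u\<in>span B. \<forall>z\<in>span B. a u z = r z"
  using assms
proof (induction B arbitrary: r rule: finite_induct)
  case empty
  have "r 0 = 0" using empty.prems(3) by (force simp: linear_map_on_def)
  then show ?case by (auto simp: form_zero)
next
  case (insert b B)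
  have sub: "span B \<subseteq> span (insert b B)" by (intro span_mono) auto
  have IH: "\<exists>u\<in>span B. \<forall>z\<in>span B. a u z = r z" if "linear_map_on (span B) r" for r
    using insert.IH[OF _ _ that] insert.prems sub posdef_subset by blast
  have rB: "linear_map_on (span B) r"
    using insert.prems(3) sub by (auto simp: linear_map_on_def subset_iff)
  show ?case
  proof (cases "b \<in> span B")
    case True
    then show ?thesis using IH[OF rB] by (simp add: span_redundant)
  next
    case False
    have bV: "b \<in> span (insert b B)" by (simp add: span_base)
    have "linear_map_on (span B) (a b)"
      using insert.prems(1) sub bV by (auto simp: linear_map_on_def form_simps subset_iff)
    then obtain p where p: "p \<in> span B" "\<forall>z\<in>span B. a p z = a b z" using IH by blast
    define e where "e = b - p"
    note e = split_off_orthogonal[OF insert.prems(1) False p, folded e_def]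
    have "a e e > 0" using insert.prems(2) e by (auto simp: posdef_def)
    obtain u where u: "u \<in> span B" "\<And>z. z \<in> span B \<Longrightarrow> a u z = r z" using IH[OF rB] by blast
    define w where "w = u + (r e / a e e) *\<^sub>R e"
    have "w \<in> span (insert b B)" using u sub e by (auto simp: w_def intro: span_add span_scale)
    moreover have "a w z = r z" if z: "z \<in> span (insert b B)" for z
    proof -
      obtain k z' where z': "z' \<in> span B" "z = z' + k *\<^sub>R e" using e(4)[OF z] by blast
      have V: "z' \<in> V" "e \<in> V" "u \<in> V" using z' sub e u insert.prems(1) by auto
      have "r z = r z' + k * r e"
        using insert.prems(3) z' e sub by (auto simp: linear_map_on_def span_scale subset_iff)
      moreover have "a u e = 0" using e(3)[OF u(1)] form_sym V by simp
      ultimately show ?thesis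
        using V z' e(3) u(2) \<open>a e e > 0\<close> by (simp add: w_def form_simps)
    qed
    ultimately show ?thesis by blast
  qed
qed

lemma riesz_ex1:
  assumes "posdef S" "S \<subseteq> V" "subspace S" "linear_map_on S r"
  shows "\<exists>!u. u \<in> S \<and> (\<forall>z\<in>S. a u z = r z)"
proof -
  obtain B where "finite B" "S = span B"
    using fin_dim_basis fin_dim_subset[OF fin_dim_V assms(2)] assms(3) by metis
  then obtain u where "u \<in> S" "\<forall>z\<in>S. a u z = r z" using riesz_span assms by blast
  then show ?thesis using posdef_eqI[OF assms(1-3)] by (intro ex1I[of _ u]) auto
qed

text \<open>
  Every local problem of the algorithm is of the form "find \<open>u \<in> S\<close> with \<open>a(u, z) = r(z)\<close> for all
  \<open>z \<in> S\<close>"; \<open>riesz S r\<close> is its solution.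
\<close>

definition riesz :: "'a set \<Rightarrow> ('a \<Rightarrow> real) \<Rightarrow> 'a" where
  "riesz S r = (THE u. u \<in> S \<and> (\<forall>z\<in>S. a u z = r z))"

lemma riesz:
  assumes "posdef S" "S \<subseteq> V" "subspace S" "linear_map_on S r"
  shows "riesz S r \<in> S" "z \<in> S \<Longrightarrow> a (riesz S r) z = r z"
  using theI'[OF riesz_ex1[OF assms]] unfolding riesz_def by auto

lemma riesz_unique:
  assumes "posdef S" "S \<subseteq> V" "subspace S" "linear_map_on S r"
    "u \<in> S" "\<And>z. z \<in> S \<Longrightarrow> a u z = r z"
  shows "u = riesz S r"
  using riesz_ex1[OF assms(1-4)] riesz[OF assms(1-4)] assms(5,6) by blast

lemma riesz_cong: "(\<And>z. z \<in> S \<Longrightarrow> r z = r' z) \<Longrightarrow> riesz S r = riesz S r'"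
  unfolding riesz_def by (metis (no_types, lifting))

lemma linear_map_on_form: "u \<in> V \<Longrightarrow> S \<subseteq> V \<Longrightarrow> linear_map_on S (a u)"
  by (auto simp: linear_map_on_def form_simps subset_iff)

text \<open>
  A finite-dimensional substitute for compactness of the unit sphere: a positive definite form
  dominates every function of quadratic growth. The constant is built up along an orthogonal
  decomposition, and each step costs a factor 2 from the bound on \<open>b (x + y)\<close>.
\<close>

lemma dominated_span:
  assumes "finite B" "span B \<subseteq> V" "posdef (span B)"
    and b: "\<And>x y. x \<in> span B \<Longrightarrow> y \<in> span B \<Longrightarrow> b (x + y) \<le> 2 * b x + 2 * b y"
    and scale: "\<And>x c. x \<in> span B \<Longrightarrow> b (c *\<^sub>R x) = c\<^sup>2 * b x"
  shows "\<exists>C>0. \<forall>x\<in>span B. b x \<le> C * a x x"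
  using assms
proof (induction B rule: finite_induct)
  case empty
  have "b 0 = 0" using empty.prems(4)[of 0 0] by simp
  then show ?case by (intro exI[of _ 1]) (simp add: form_zero)
next
  case (insert v B)
  have sub: "span B \<subseteq> span (insert v B)" by (intro span_mono) auto
  obtain C where C: "C > 0" "\<And>x. x \<in> span B \<Longrightarrow> b x \<le> C * a x x"
    using insert.IH insert.prems sub posdef_subset[OF insert.prems(2) sub] by (auto simp: subset_iff)
  show ?case
  proof (cases "v \<in> span B")
    case True
    then show ?thesis using C by (auto simp: span_redundant)
  next
    case False
    have vV: "v \<in> V" using insert.prems(1) by (auto simp: span_base)
    have BV: "span B \<subseteq> V" using sub insert.prems(1) by blast
    obtain p where p: "p \<in> span B" "\<forall>z\<in>span B. a p z = a v z"
      using riesz_span[OF insert.hyps(1) BV posdef_subset[OF insert.prems(2) sub]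
          linear_map_on_form[OF vV BV]] by blast
    define e where "e = v - p"
    note e = split_off_orthogonal[OF insert.prems(1) False p, folded e_def]
    have ee: "a e e > 0" using insert.prems(2) e by (auto simp: posdef_def)
    define C' where "C' = 2 * max C (b e / a e e)"
    have "b x \<le> C' * a x x" if x: "x \<in> span (insert v B)" for x
    proof -
      obtain k x' where x': "x' \<in> span B" "x = x' + k *\<^sub>R e" using e(4)[OF x] by blast
      have V: "x' \<in> V" "e \<in> V" using x' sub e insert.prems(1) by auto
      have "a x' e = 0" using e(3)[OF x'(1)] form_sym V by simp
      then have axx: "a x x = a x' x' + k\<^sup>2 * a e e"
        unfolding x' energy_scale_add[OF V] by simp
      have "b x \<le> 2 * b x' + 2 * b (k *\<^sub>R e)"
        unfolding x' using insert.prems(3) x' sub e by (auto simp: span_scale subset_iff)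
      also have "b (k *\<^sub>R e) = (b e / a e e) * (k\<^sup>2 * a e e)"
        using insert.prems(4)[OF e(1)] ee by simp
      also have "2 * b x' + 2 * (b e / a e e * (k\<^sup>2 * a e e)) \<le>
          2 * (max C (b e / a e e) * a x' x') + 2 * (max C (b e / a e e) * (k\<^sup>2 * a e e))"
      proof (intro add_mono mult_left_mono mult_right_mono)
        have "b x' \<le> C * a x' x'" using C x' by blast
        also have "\<dots> \<le> max C (b e / a e e) * a x' x'"
          using form_nonneg[OF V(1)] by (intro mult_right_mono) auto
        finally show "b x' \<le> max C (b e / a e e) * a x' x'" .
      qed (use ee in auto)
      also have "\<dots> = C' * a x x" by (simp add: C'_def axx algebra_simps)
      finally show ?thesis .
    qed
    moreover have "C' > 0" using C(1) by (auto simp: C'_def)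
    ultimately show ?thesis by blast
  qed
qed

end

context energy_form begin

text \<open>
  The supremum \<open>l\<close> of the Rayleigh quotient is attained: otherwise \<open>l I - T\<close> would give a positive
  definite form, which dominates a positive multiple of \<open>a\<close> by \<open>dominated_span\<close>, and \<open>l\<close> could be
  lowered. At a maximizer the semidefinite form of \<open>l I - T\<close> is stationary, and this is the eigenvalue
  equation. Symmetry of \<open>T\<close> makes \<open>a (T u) v\<close> linear in \<open>u\<close>, so that \<open>l I - T\<close> does define an energy form.
\<close>

lemma self_adjoint_has_eigenvector:
  assumes S: "subspace S" "S \<subseteq> V" "posdef S" "S \<noteq> {0}"
    and T: "\<And>u. u \<in> S \<Longrightarrow> T u \<in> S"
    and sym: "\<And>u v. u \<in> S \<Longrightarrow> v \<in> S \<Longrightarrow> a (T u) v = a u (T v)"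
    and bound: "\<And>u. u \<in> S \<Longrightarrow> a (T u) u \<le> C * a u u"
  shows "\<exists>l. \<exists>u\<in>S. u \<noteq> 0 \<and> T u = l *\<^sub>R u"
proof -
  note inS [simp] = subspace_0[OF S(1)] subspace_add[OF S(1)] subspace_scale[OF S(1)]
    subspace_diff[OF S(1)] T
  have inV [simp]: "u \<in> S \<Longrightarrow> u \<in> V" for u using S(2) by blast
  have pos: "0 < a u u" if "u \<in> S" "u \<noteq> 0" for u
    using S(3) that by (simp add: posdef_def)
  define R where "R u = a (T u) u / a u u" for u
  define l where "l = (SUP u\<in>S - {0}. R u)"
  have "R u \<le> C" if "u \<in> S - {0}" for u
    using bound[of u] pos[of u] that by (simp add: R_def divide_le_eq)
  then have bdd: "bdd_above (R ` (S - {0}))"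
    by (intro bdd_aboveI[of _ C]) auto
  obtain u0 where u0: "u0 \<in> S - {0}" using S(4) inS(1) by blast
  define s where "s u v = l * a u v - a (T u) v" for u v
  have s_nonneg: "0 \<le> s u u" if u: "u \<in> S" for u
  proof (cases "u = 0")
    case False
    then have "R u \<le> l" unfolding l_def using u bdd by (intro cSUP_upper) auto
    then show ?thesis using pos[OF u False] by (simp add: R_def s_def field_simps)
  qed (simp add: s_def form_zero)
  have Tform: "a (T (x + y)) z = a (T x) z + a (T y) z" "a (T (c *\<^sub>R x)) z = c * a (T x) z"
    if "x \<in> S" "y \<in> S" "z \<in> S" for x y z c
    using that by (simp_all add: sym form_simps)
  interpret s: energy_form S s
  proof
    show "subspace S" by fact
    show "fin_dim S" using fin_dim_V S(2) by (rule fin_dim_subset)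
    show "s x y = s y x" if "x \<in> S" "y \<in> S" for x y
      unfolding s_def using that sym[of x y] form_sym[of x y] form_sym[of x "T y"] by simp
    show "0 \<le> s x x" if "x \<in> S" for x by (rule s_nonneg[OF that])
  qed (auto simp: s_def form_simps Tform algebra_simps)
  have "\<not> s.posdef S"
  proof
    assume "s.posdef S"
    moreover obtain B where "finite B" "S = span B" using fin_dim_basis[OF s.fin_dim_V S(1)] .
    moreover have "a (x + y) (x + y) \<le> 2 * a x x + 2 * a y y" if "x \<in> S" "y \<in> S" for x y
    proof -
      have "0 \<le> a (x - y) (x - y)" using that by (intro form_nonneg) simp
      then show ?thesis using that form_sym[of x y] by (simp add: form_simps)
    qed
    moreover have "a (c *\<^sub>R x) (c *\<^sub>R x) = c\<^sup>2 * a x x" if "x \<in> S" for x c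
      using that by (simp add: form_simps power2_eq_square)
    ultimately obtain K where K: "K > 0" "\<And>x. x \<in> S \<Longrightarrow> a x x \<le> K * s x x"
      using s.dominated_span[of B "\<lambda>x. a x x"] by auto
    have "R u \<le> l - 1 / K" if u: "u \<in> S - {0}" for u
    proof -
      have "a u u \<le> K * (l * a u u - a (T u) u)" using K(2) u by (simp add: s_def)
      then have "a (T u) u \<le> (l - 1 / K) * a u u" using K(1) by (simp add: field_simps)
      then show ?thesis using pos[of u] u by (simp add: R_def divide_le_eq)
    qed
    then have "l \<le> l - 1 / K" unfolding l_def using u0 by (intro cSUP_least) auto
    then show False using K(1) by simp
  qed
  then obtain u where u: "u \<in> S" "u \<noteq> 0" "s u u = 0"
    using s_nonneg unfolding s.posdef_def by force
  have "T u = l *\<^sub>R u"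
  proof (rule posdef_eqI[OF S(3,2,1)])
    fix z assume z: "z \<in> S"
    have "s u z = 0"
      using u z s_nonneg by (intro s.stationary_at_minimum) auto
    then show "a (T u) z = a (l *\<^sub>R u) z"
      using u z by (simp add: s_def form_simps)
  qed (use u in auto)
  with u show ?thesis by blast
qed

lemma orthogonal_imp_independent:
  assumes "X \<subseteq> V" "\<And>x. x \<in> X \<Longrightarrow> a x x \<noteq> 0"
    and orth: "\<And>x y. x \<in> X \<Longrightarrow> y \<in> X \<Longrightarrow> x \<noteq> y \<Longrightarrow> a x y = 0"
  shows "independent X"
  unfolding independent_explicit_module
proof (intro allI impI)
  fix t c v
  assume t: "finite t" "t \<subseteq> X" and sum: "(\<Sum>v\<in>t. c v *\<^sub>R v) = 0" and v: "v \<in> t"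
  have "a (\<Sum>v\<in>r. c v *\<^sub>R v) v = (\<Sum>w\<in>r. c w * a w v) \<and> (\<Sum>v\<in>r. c v *\<^sub>R v) \<in> V" if "r \<subseteq> t" for r
    using finite_subset[OF that t(1)] that
  proof (induction r rule: finite_induct)
    case (insert x r)
    then have "x \<in> V" "v \<in> V" using t assms(1) v by auto
    then show ?case using insert by (simp add: form_simps)
  qed (use v t assms(1) in \<open>auto simp: form_zero\<close>)
  then have "0 = (\<Sum>w\<in>t. c w * a w v)"
    using sum v t assms(1) form_zero(1)[of v] by force
  also have "\<dots> = (\<Sum>w\<in>t. if w = v then c v * a v v else 0)"
    using t v orth by (intro sum.cong) auto
  also have "\<dots> = c v * a v v" using t v by simp
  finally show "c v = 0" using assms(2) t v by auto
qed

lemma finite_eigenvalues_self_adjoint: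
  assumes S: "subspace S" "S \<subseteq> V" "posdef S"
    and T: "\<And>u. u \<in> S \<Longrightarrow> T u \<in> S"
    and sym: "\<And>u v. u \<in> S \<Longrightarrow> v \<in> S \<Longrightarrow> a (T u) v = a u (T v)"
  shows "finite (eigenvalues_on S T)"
proof -
  have "\<forall>l\<in>eigenvalues_on S T. \<exists>u. u \<in> S \<and> u \<noteq> 0 \<and> T u = l *\<^sub>R u"
    by (auto simp: eigenvalues_on_def)
  from bchoice[OF this] obtain f where
    f: "\<And>l. l \<in> eigenvalues_on S T \<Longrightarrow> f l \<in> S \<and> f l \<noteq> 0 \<and> T (f l) = l *\<^sub>R f l"
    by blast
  have V: "f l \<in> V" if "l \<in> eigenvalues_on S T" for l using f[OF that] S(2) by auto
  have inj: "inj_on f (eigenvalues_on S T)"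
    by (intro inj_onI) (metis f scaleR_cancel_right)
  have "independent (f ` eigenvalues_on S T)"
  proof (rule orthogonal_imp_independent)
    show "f ` eigenvalues_on S T \<subseteq> V" using V by auto
    show "a x x \<noteq> 0" if "x \<in> f ` eigenvalues_on S T" for x
      using that f posdef_zero[OF S(3)] by force
    fix x y assume "x \<in> f ` eigenvalues_on S T" "y \<in> f ` eigenvalues_on S T" and "x \<noteq> y"
    then obtain l m where lm: "l \<in> eigenvalues_on S T" "m \<in> eigenvalues_on S T"
      and xy: "x = f l" "y = f m" by blast
    have "l * a x y = m * a x y"
      using sym[of x y] f[OF lm(1)] f[OF lm(2)] V[OF lm(1)] V[OF lm(2)]
      by (simp add: xy form_simps)
    then show "a x y = 0" using \<open>x \<noteq> y\<close> xy by auto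
  qed
  moreover obtain B where B: "finite B" "V \<subseteq> span B" using fin_dim_V by (auto simp: fin_dim_def)
  ultimately have "finite (f ` eigenvalues_on S T)"
    using independent_span_bound[OF B(1)] V B(2) by blast
  then show ?thesis using inj by (rule finite_imageD)
qed

end

section \<open>The multilevel preconditioner\<close>

text \<open>
  What the proof uses of the hierarchy. The spaces \<open>WD i\<close> and \<open>WT i\<close> are \<open>W_Delta\<close> and \<open>W_tilde\<close>, \<open>UI i\<close> are
  the interior functions, and \<open>U (Suc i)\<close> takes the place of \<open>W_Pi\<close> at level \<open>i\<close>, described as the
  orthogonal complement of \<open>WD i\<close> in \<open>WT i\<close>. The projection \<open>P\<^sub>i w\<close> is \<open>riesz (UI i) (a w)\<close>.
\<close>

locale multilevel_spaces = energy_form V a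
  for V :: "'a::real_vector set" and a :: "'a \<Rightarrow> 'a \<Rightarrow> real" +
  fixes L :: nat and U UI WD WT :: "nat \<Rightarrow> 'a set" and E :: "nat \<Rightarrow> 'a \<Rightarrow> 'a" and \<omega> :: "nat \<Rightarrow> real"
  assumes subspaces: "i \<in> {1..<L} \<Longrightarrow> subspace (U i)" "i \<in> {1..<L} \<Longrightarrow> subspace (UI i)"
      "i \<in> {1..<L} \<Longrightarrow> subspace (WD i)" "i \<in> {1..<L} \<Longrightarrow> subspace (WT i)"
    and inclusions: "i \<in> {1..<L} \<Longrightarrow> UI i \<subseteq> U i" "i \<in> {1..<L} \<Longrightarrow> WD i \<subseteq> WT i"
      "i \<in> {1..<L} \<Longrightarrow> WT i \<subseteq> V"
    and posdef_WT: "i \<in> {1..<L} \<Longrightarrow> posdef (WT i)"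
    and coarse_space: "i \<in> {1..<L} \<Longrightarrow> U (Suc i) = {w \<in> WT i. \<forall>z\<in>WD i. a w z = 0}"
    and projection: "i \<in> {1..<L} \<Longrightarrow> linear_projection_onto (WT i) (U i) (E i)"
    and omega: "i \<in> {1..<L} \<Longrightarrow> 1 \<le> \<omega> i"
    and averaging_bound: "i \<in> {1..<L} \<Longrightarrow> w \<in> WT i \<Longrightarrow>
      a (E i w - riesz (UI i) (a (E i w))) (E i w - riesz (UI i) (a (E i w))) \<le> \<omega> i * a w w"
begin

lemma projectionD:
  assumes "i \<in> {1..<L}"
  shows "U i \<subseteq> WT i" "w \<in> WT i \<Longrightarrow> E i w \<in> U i" "u \<in> U i \<Longrightarrow> E i u = u"
    "x \<in> WT i \<Longrightarrow> y \<in> WT i \<Longrightarrow> E i (x + y) = E i x + E i y"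
    "x \<in> WT i \<Longrightarrow> E i (c *\<^sub>R x) = c *\<^sub>R E i x"
  using projection[OF assms] by (auto simp: linear_projection_onto_def linear_map_on_def)

lemma coarse_subset: "i \<in> {1..<L} \<Longrightarrow> U (Suc i) \<subseteq> WT i"
  using coarse_space by auto

lemma coarse_subspace:
  assumes i: "i \<in> {1..<L}"
  shows "subspace (U (Suc i))"
  unfolding coarse_space[OF i]
  using inclusions[OF i] subspaces(4)[OF i] by (intro subspace_orthogonal) auto

lemma U_structure:
  assumes "i \<in> {1..L}" "2 \<le> L"
  shows "subspace (U i)" "U i \<subseteq> V" "posdef (U i)"
proof -
  consider "i \<in> {1..<L}" | j where "i = Suc j" "j \<in> {1..<L}"
    using assms by (cases i) force+
  then have "subspace (U i) \<and> (\<exists>j\<in>{1..<L}. U i \<subseteq> WT j)"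
  proof cases
    case 1 then show ?thesis using subspaces(1) projectionD(1) by blast
  next
    case 2 then show ?thesis using coarse_subspace coarse_subset by blast
  qed
  then show "subspace (U i)" "U i \<subseteq> V" "posdef (U i)"
    using inclusions(3) posdef_WT posdef_subset by blast+
qed

lemma test_spaces:
  assumes i: "i \<in> {1..<L}"
  shows "U i \<subseteq> V" "posdef (U i)" "UI i \<subseteq> V" "posdef (UI i)" "WD i \<subseteq> V" "posdef (WD i)"
    "U (Suc i) \<subseteq> V" "posdef (U (Suc i))"
proof -
  have "S \<subseteq> V \<and> posdef S" if "S \<subseteq> WT i" for S
    using that inclusions(3)[OF i] posdef_subset[OF posdef_WT[OF i] that] by blast
  then show "U i \<subseteq> V" "posdef (U i)" "UI i \<subseteq> V" "posdef (UI i)" "WD i \<subseteq> V" "posdef (WD i)"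
    "U (Suc i) \<subseteq> V" "posdef (U (Suc i))"
    using projectionD(1)[OF i] inclusions(1,2)[OF i] coarse_subset[OF i] by blast+
qed

text \<open>
  The functionals \<open>r\<^sub>B\<close> and \<open>z \<mapsto> r\<^sub>B (E z)\<close> and the map \<open>I - P\<^sub>i\<close> of the algorithm.
\<close>

definition interior_residual :: "nat \<Rightarrow> ('a \<Rightarrow> real) \<Rightarrow> 'a \<Rightarrow> real" where
  "interior_residual i r v = r v - a (riesz (UI i) r) v"

definition averaged_residual :: "nat \<Rightarrow> ('a \<Rightarrow> real) \<Rightarrow> 'a \<Rightarrow> real" where
  "averaged_residual i r z = interior_residual i r (E i z)"

definition interior_correction :: "nat \<Rightarrow> 'a \<Rightarrow> 'a" where
  "interior_correction i u = u - riesz (UI i) (a u)"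

text \<open>
  The algorithm as a recursive function: \<open>precond n i\<close> is the preconditioner started at level \<open>i\<close> when \<open>n\<close>
  further levels follow. With \<open>n = 0\<close> the level is the coarsest one, where the problem is solved
  exactly.
\<close>

fun precond :: "nat \<Rightarrow> nat \<Rightarrow> ('a \<Rightarrow> real) \<Rightarrow> 'a" where
  "precond 0 i r = riesz (U i) r"
| "precond (Suc n) i r = riesz (UI i) r + interior_correction i
     (E i (riesz (WD i) (averaged_residual i r) + precond n (Suc i) (averaged_residual i r)))"

lemma linear_residuals:
  assumes i: "i \<in> {1..<L}" and r: "linear_map_on (U i) r"
  shows "linear_map_on (UI i) r" "linear_map_on (U i) (interior_residual i r)"
    "linear_map_on (WT i) (averaged_residual i r)"
    "linear_map_on (WD i) (averaged_residual i r)"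
    "linear_map_on (U (Suc i)) (averaged_residual i r)"
proof -
  have mono: "linear_map_on T f" if "linear_map_on S f" "T \<subseteq> S" for S T and f :: "'a \<Rightarrow> real"
    using that by (auto simp: linear_map_on_def subset_iff)
  show UI: "linear_map_on (UI i) r" using mono[OF r inclusions(1)[OF i]] .
  have uI: "riesz (UI i) r \<in> V"
    using riesz(1)[OF test_spaces(4,3)[OF i] subspaces(2)[OF i] UI] test_spaces(3)[OF i] by blast
  show B: "linear_map_on (U i) (interior_residual i r)"
    using r linear_map_on_form[OF uI test_spaces(1)[OF i]]
    by (simp add: linear_map_on_def interior_residual_def algebra_simps)
  show W: "linear_map_on (WT i) (averaged_residual i r)"
    using B projectionD[OF i] by (simp add: linear_map_on_def averaged_residual_def)
  show "linear_map_on (WD i) (averaged_residual i r)"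
    "linear_map_on (U (Suc i)) (averaged_residual i r)"
    using mono[OF W] inclusions(2)[OF i] coarse_subset[OF i] by auto
qed

text \<open>
  Only the values on \<open>U i\<close> matter; this links residuals that are restricted to \<open>U i\<close>, as elements of the
  dual space, with the unrestricted functionals used here.
\<close>

lemma precond_cong:
  assumes "i \<in> {1..L}" "i + n = L" "\<And>z. z \<in> U i \<Longrightarrow> r z = r' z"
  shows "precond n i r = precond n i r'"
  using assms
proof (induction n arbitrary: i r r')
  case 0
  then show ?case by (auto intro: riesz_cong)
next
  case (Suc n)
  then have i: "i \<in> {1..<L}" by auto
  have UI: "riesz (UI i) r = riesz (UI i) r'"
    using Suc.prems(3) inclusions(1)[OF i] by (intro riesz_cong) auto
  have av: "averaged_residual i r z = averaged_residual i r' z" if "z \<in> WT i" for z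
    using Suc.prems(3) projectionD(2)[OF i that] UI
    by (simp add: averaged_residual_def interior_residual_def)
  have "riesz (WD i) (averaged_residual i r) = riesz (WD i) (averaged_residual i r')"
    using av inclusions(2)[OF i] by (intro riesz_cong) auto
  moreover have "precond n (Suc i) (averaged_residual i r) = precond n (Suc i) (averaged_residual i r')"
    using av coarse_subset[OF i] Suc.prems i by (intro Suc.IH) auto
  ultimately show ?case by (simp add: UI)
qed

lemma interior_correction:
  assumes i: "i \<in> {1..<L}" and u: "u \<in> U i"
  shows "interior_correction i u \<in> U i"
    "z \<in> UI i \<Longrightarrow> a (interior_correction i u) z = 0"
    "riesz (UI i) (a u) \<in> UI i"
proof -
  have uV: "u \<in> V" using u test_spaces(1)[OF i] by auto
  note P = riesz[OF test_spaces(4,3)[OF i] subspaces(2)[OF i] linear_map_on_form[OF uV test_spaces(3)[OF i]]]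
  show "riesz (UI i) (a u) \<in> UI i" by (rule P(1))
  then show "interior_correction i u \<in> U i"
    using u inclusions(1)[OF i] subspaces(1)[OF i]
    by (auto simp: interior_correction_def intro: subspace_diff)
  show "a (interior_correction i u) z = 0" if "z \<in> UI i"
    using that uV P test_spaces(3)[OF i] by (simp add: interior_correction_def form_simps subset_iff)
qed

lemma precond_in_U:
  assumes "i \<in> {1..L}" "i + n = L" "2 \<le> L" "linear_map_on (U i) r"
  shows "precond n i r \<in> U i"
  using assms
proof (induction n arbitrary: i r)
  case 0
  then show ?case using riesz(1) U_structure by simp
next
  case (Suc n)
  then have i: "i \<in> {1..<L}" by auto
  note lin = linear_residuals[OF i Suc.prems(4)]
  have "riesz (UI i) r \<in> U i"
    using riesz(1)[OF test_spaces(4,3)[OF i] subspaces(2)[OF i] lin(1)] inclusions(1)[OF i] by blast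
  moreover have "precond n (Suc i) (averaged_residual i r) \<in> WT i"
    using Suc.IH[OF _ _ _ lin(5)] Suc.prems i coarse_subset[OF i] by auto
  moreover have "riesz (WD i) (averaged_residual i r) \<in> WT i"
    using riesz(1)[OF test_spaces(6,5)[OF i] subspaces(3)[OF i] lin(4)] inclusions(2)[OF i] by blast
  ultimately show ?case
    using subspaces(1,4)[OF i] projectionD(2)[OF i] interior_correction(1)[OF i]
    by (simp add: subspace_add)
qed

text \<open>
  Orthogonality moves the projection from \<open>x\<close> to the interior solution:
  \<open>r (P x) = a(u\<^sub>I, P x) = a(u\<^sub>I, x)\<close>.
\<close>

lemma residual_of_correction:
  assumes i: "i \<in> {1..<L}" and r: "linear_map_on (U i) r" and x: "x \<in> U i"
  shows "r (interior_correction i x) = interior_residual i r x"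
proof -
  have UI: "UI i \<subseteq> U i" "UI i \<subseteq> V" using inclusions(1)[OF i] test_spaces(3)[OF i] by auto
  have xV: "x \<in> V" using x test_spaces(1)[OF i] by auto
  let ?p = "riesz (UI i) (a x)"
  note R = riesz[OF test_spaces(4,3)[OF i] subspaces(2)[OF i]]
  note lin = linear_residuals(1)[OF i r]
  have p: "?p \<in> UI i" by (rule interior_correction(3)[OF i x])
  have c: "interior_correction i x \<in> U i" by (rule interior_correction(1)[OF i x])
  have "r x = r (interior_correction i x + ?p)" by (simp add: interior_correction_def)
  also have "\<dots> = r (interior_correction i x) + r ?p"
    using r c p UI by (auto simp: linear_map_on_def)
  also have "r ?p = a (riesz (UI i) r) ?p" using R(2)[OF lin p] by simp
  also have "\<dots> = a ?p (riesz (UI i) r)" using R(1)[OF lin] p UI form_sym by blast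
  also have "\<dots> = a x (riesz (UI i) r)"
    using R(2)[OF linear_map_on_form[OF xV UI(2)] R(1)[OF lin]] .
  also have "\<dots> = a (riesz (UI i) r) x" using R(1)[OF lin] xV UI form_sym by blast
  finally show ?thesis by (simp add: interior_residual_def)
qed

text \<open>
  The form in which the recursion is used. It is symmetric in \<open>r\<close> and \<open>r'\<close> except for the coarse term, to
  which an induction hypothesis applies, and for \<open>r = r'\<close> it expresses \<open>r (B r)\<close> as two energies
  and a coarse contribution.
\<close>

lemma precond_split:
  assumes "i \<in> {1..<L}" "i + Suc n = L" "2 \<le> L" "linear_map_on (U i) r" "linear_map_on (U i) r'"
  shows "r' (precond (Suc n) i r) = a (riesz (UI i) r') (riesz (UI i) r) +
     a (riesz (WD i) (averaged_residual i r')) (riesz (WD i) (averaged_residual i r)) +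
     averaged_residual i r' (precond n (Suc i) (averaged_residual i r))"
proof -
  note i = assms(1)
  note lin = linear_residuals[OF i assms(4)] and lin' = linear_residuals[OF i assms(5)]
  let ?d = "riesz (WD i) (averaged_residual i r)" and ?c = "precond n (Suc i) (averaged_residual i r)"
  note RI = riesz[OF test_spaces(4,3)[OF i] subspaces(2)[OF i]]
  note RD = riesz[OF test_spaces(6,5)[OF i] subspaces(3)[OF i]]
  have uI: "riesz (UI i) r \<in> UI i" by (rule RI(1)[OF lin(1)])
  have d: "?d \<in> WD i" by (rule RD(1)[OF lin(4)])
  have c: "?c \<in> WT i"
    using precond_in_U[OF _ _ assms(3) lin(5), of n] assms(2) coarse_subset[OF i] i by auto
  have w: "?d + ?c \<in> WT i" using c d inclusions(2)[OF i] subspaces(4)[OF i] by (auto intro: subspace_add)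
  have "r' (precond (Suc n) i r) = r' (riesz (UI i) r) + r' (interior_correction i (E i (?d + ?c)))"
    using assms(5) uI inclusions(1)[OF i] interior_correction(1)[OF i projectionD(2)[OF i w]]
    by (auto simp: linear_map_on_def)
  also have "r' (riesz (UI i) r) = a (riesz (UI i) r') (riesz (UI i) r)"
    using RI(2)[OF lin'(1) uI] by simp
  also have "r' (interior_correction i (E i (?d + ?c))) = averaged_residual i r' (?d + ?c)"
    using residual_of_correction[OF i assms(5) projectionD(2)[OF i w]] by (simp add: averaged_residual_def)
  also have "\<dots> = averaged_residual i r' ?d + averaged_residual i r' ?c"
    using lin'(3) d c inclusions(2)[OF i] by (auto simp: linear_map_on_def)
  also have "averaged_residual i r' ?d = a (riesz (WD i) (averaged_residual i r')) ?d"
    using RD(2)[OF lin'(4) d] by simp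
  finally show ?thesis by simp
qed

lemma precond_sym:
  assumes "i \<in> {1..L}" "i + n = L" "2 \<le> L" "linear_map_on (U i) r" "linear_map_on (U i) r'"
  shows "r' (precond n i r) = r (precond n i r')"
  using assms
proof (induction n arbitrary: i r r')
  case 0
  note R = riesz[OF U_structure(3)[OF 0(1,3)] U_structure(2,1)[OF 0(1,3)]]
  show ?case
    using R(2)[OF 0(4) R(1)[OF 0(5)]] R(2)[OF 0(5) R(1)[OF 0(4)]]
      R(1)[OF 0(4)] R(1)[OF 0(5)] U_structure(2)[OF 0(1,3)] form_sym by (metis precond.simps(1) subsetD)
next
  case (Suc n)
  then have i: "i \<in> {1..<L}" by auto
  note lin = linear_residuals[OF i Suc.prems(4)] and lin' = linear_residuals[OF i Suc.prems(5)]
  have "averaged_residual i r' (precond n (Suc i) (averaged_residual i r)) =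
      averaged_residual i r (precond n (Suc i) (averaged_residual i r'))"
    using Suc.IH[OF _ _ _ lin(5) lin'(5)] Suc.prems i by auto
  moreover have "a (riesz (UI i) r') (riesz (UI i) r) = a (riesz (UI i) r) (riesz (UI i) r')"
    using riesz(1)[OF test_spaces(4,3)[OF i] subspaces(2)[OF i]] lin(1) lin'(1) test_spaces(3)[OF i]
    by (intro form_sym) auto
  moreover have "a (riesz (WD i) (averaged_residual i r')) (riesz (WD i) (averaged_residual i r)) =
      a (riesz (WD i) (averaged_residual i r)) (riesz (WD i) (averaged_residual i r'))"
    using riesz(1)[OF test_spaces(6,5)[OF i] subspaces(3)[OF i]] lin(4) lin'(4) test_spaces(5)[OF i]
    by (intro form_sym) auto
  ultimately show ?case
    using precond_split[OF i Suc.prems(2,3,4,5)] precond_split[OF i Suc.prems(2,3,5,4)] by linarith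
qed

text \<open>
  The step of the induction, for an exact coarse solve; see the introduction for the argument. Here
  \<open>w\<close> is represented by its components in \<open>WD i\<close> and \<open>U (Suc i)\<close>, and \<open>r (riesz (U i) r) - e\<close> is the
  energy of \<open>b\<close>.
\<close>

lemma two_level_bounds:
  assumes i: "i \<in> {1..<L}" and r: "linear_map_on (U i) r"
  defines "rW \<equiv> averaged_residual i r"
  defines "e \<equiv> a (riesz (UI i) r) (riesz (UI i) r)"
    and "w \<equiv> riesz (WD i) rW + riesz (U (Suc i)) rW"
  shows "r (riesz (U i) r) - e \<le> a w w" "a w w \<le> \<omega> i * (r (riesz (U i) r) - e)"
    "0 \<le> e" "a w w = a (riesz (WD i) rW) (riesz (WD i) rW) + rW (riesz (U (Suc i)) rW)"
proof -
  note lin = linear_residuals[OF i r, folded rW_def]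
  define u where "u = riesz (U i) r"
  define b where "b = interior_correction i u"
  define uI where "uI = riesz (UI i) r"
  note UV = test_spaces(1)[OF i] and UIV = test_spaces(3)[OF i] and WV = inclusions(3)[OF i]
  note R = riesz[OF test_spaces(2,1)[OF i] subspaces(1)[OF i] r, folded u_def]
  note RI = riesz[OF test_spaces(4,3)[OF i] subspaces(2)[OF i] lin(1), folded uI_def]
  note RD = riesz[OF test_spaces(6,5)[OF i] subspaces(3)[OF i] lin(4)]
  note RC = riesz[OF test_spaces(8,7)[OF i] coarse_subspace[OF i] lin(5)]
  have uV: "u \<in> V" "uI \<in> V" using R(1) RI(1) UV UIV by auto
  have uI: "uI = riesz (UI i) (a u)"
    using RI R(2) inclusions(1)[OF i]
    by (intro riesz_unique[OF test_spaces(4,3)[OF i] subspaces(2)[OF i] linear_map_on_form[OF uV(1) UIV]]) auto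
  have bu: "b = u - uI" by (simp add: b_def interior_correction_def uI)
  note b = interior_correction(1,2)[OF i R(1), folded b_def]
  have bV: "b \<in> V" using b(1) UV by auto
  have res: "interior_residual i r x = a b x" if "x \<in> U i" for x
    using R(2)[OF that] UV that uV by (auto simp: interior_residual_def bu uI_def[symmetric] form_simps)
  have ubb: "r (riesz (U i) r) - e = a b b"
  proof -
    have "a b uI = 0" "a uI b = 0" using b(2)[OF RI(1)] form_sym bV uV by auto
    moreover have "r u = a (b + uI) (b + uI)" using R by (simp add: bu)
    ultimately show ?thesis
      using bV uV by (simp add: form_simps e_def u_def uI_def)
  qed
  define d c where "d = riesz (WD i) rW" and "c = riesz (U (Suc i)) rW"
  have w: "w = d + c" by (simp add: w_def d_def c_def)
  have d: "d \<in> WD i" "\<And>z. z \<in> WD i \<Longrightarrow> a d z = rW z" using RD by (auto simp: d_def)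
  have c: "c \<in> U (Suc i)" "\<And>z. z \<in> U (Suc i) \<Longrightarrow> a c z = rW z" using RC by (auto simp: c_def)
  have dcV: "d \<in> V" "c \<in> V" using d(1) c(1) test_spaces[OF i] by auto
  have orth: "a y z = 0" "a z y = 0" if "y \<in> U (Suc i)" "z \<in> WD i" for y z
    using that coarse_space[OF i] test_spaces(5,7)[OF i] form_sym[of z y] by auto
  have wW: "w \<in> WT i"
    using d(1) c(1) inclusions(2)[OF i] coarse_subset[OF i] subspaces(4)[OF i]
    unfolding w by (blast intro: subspace_add)
  have wV: "w \<in> V" using wW WV by auto
  have wz: "a w z = rW z" if z: "z \<in> WT i" for z
  proof -
    \<comment> \<open>Test functions are split like \<open>w\<close>: \<open>p\<close> is the component of \<open>z\<close> in \<open>WD i\<close>.\<close>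
    have zV: "z \<in> V" using z WV by auto
    define p where "p = riesz (WD i) (a z)"
    note P = riesz[OF test_spaces(6,5)[OF i] subspaces(3)[OF i] linear_map_on_form[OF zV test_spaces(5)[OF i]], folded p_def]
    have pV: "p \<in> V" using P(1) test_spaces(5)[OF i] by auto
    have q: "z - p \<in> U (Suc i)"
      using P z zV pV inclusions(2)[OF i] subspaces(4)[OF i] test_spaces(5)[OF i]
      by (auto simp: coarse_space[OF i] form_simps subset_iff intro: subspace_diff)
    have "rW z = rW (p + (z - p))" by simp
    also have "\<dots> = rW p + rW (z - p)"
      using lin(3) P(1) q inclusions(2)[OF i] coarse_subset[OF i] unfolding linear_map_on_def by blast
    also have "\<dots> = a d p + a c (z - p)" using d(2)[OF P(1)] c(2)[OF q] by simp
    also have "\<dots> = a w p + a w (z - p)"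
      using orth[OF c(1) P(1)] orth[OF q d(1)] dcV pV zV unfolding w by (simp add: form_add)
    also have "\<dots> = a w z" using wV zV pV by (simp add: form_simps)
    finally show ?thesis by simp
  qed
  show "a w w = a d d + rW c"
    using c orth[OF c(1) d(1)] dcV by (simp add: w form_simps)
  \<comment> \<open>Since \<open>E i b = b\<close>, expanding this square with \<open>a(w, b) = a(b, b)\<close> leaves \<open>a(w, w) - a(b, b)\<close>.\<close>
  have "0 \<le> a (w - b) (w - b)" using wV bV by (intro form_nonneg) simp
  moreover have wb: "a w b = a b b"
    using wz[of b] b(1) projectionD(1,3)[OF i] res[OF b(1)] by (auto simp: rW_def averaged_residual_def)
  ultimately show "r (riesz (U i) r) - e \<le> a w w"
    unfolding ubb using wV bV form_sym[of w b] by (simp add: form_simps)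
  define x where "x = interior_correction i (E i w)"
  have EU: "E i w \<in> U i" by (rule projectionD(2)[OF i wW])
  have pUI: "riesz (UI i) (a (E i w)) \<in> UI i" by (rule interior_correction(3)[OF i EU])
  have xV: "x \<in> V" using interior_correction(1)[OF i EU] UV by (auto simp: x_def)
  have "a w w = a b (E i w)"
    using wz[OF wW] res[OF EU] by (simp add: rW_def averaged_residual_def)
  also have "\<dots> = a b x"
    using b(2)[OF pUI] bV EU UV pUI UIV by (auto simp: x_def interior_correction_def form_simps subset_iff)
  finally have bx: "a b x = a w w" by simp
  have "a x x \<le> \<omega> i * a w w"
    using averaging_bound[OF i wW] by (simp add: x_def interior_correction_def)
  \<comment> \<open>The multiple \<open>\<omega> i\<close> balances the mixed term \<open>a(b, x) = a(w, w)\<close> against the bound on \<open>a(x, x)\<close>.\<close>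
  moreover have "0 \<le> a (\<omega> i *\<^sub>R b - x) (\<omega> i *\<^sub>R b - x)" using bV xV by (intro form_nonneg) simp
  then have "0 \<le> \<omega> i * (\<omega> i * a b b) - 2 * (\<omega> i * a w w) + a x x"
    using bV xV bx form_sym[of x b] by (simp add: form_simps algebra_simps)
  ultimately have "\<omega> i * a w w \<le> \<omega> i * (\<omega> i * a b b)" by linarith
  then show "a w w \<le> \<omega> i * (r (riesz (U i) r) - e)"
    unfolding ubb using omega[OF i] by simp
  show "0 \<le> e" unfolding e_def using uV(2) form_nonneg by (simp add: uI_def)
qed

lemma precond_bounds:
  assumes "i \<in> {1..L}" "i + n = L" "2 \<le> L" "linear_map_on (U i) r"
  shows "r (riesz (U i) r) \<le> r (precond n i r) \<and>
    r (precond n i r) \<le> (\<Prod>j\<in>{i..<L}. \<omega> j) * r (riesz (U i) r)"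
  using assms
proof (induction n arbitrary: i r)
  case 0
  then show ?case by simp
next
  case (Suc n)
  then have i: "i \<in> {1..<L}" by auto
  note lin = linear_residuals[OF i Suc.prems(4)]
  define \<Omega> where "\<Omega> = (\<Prod>j\<in>{Suc i..<L}. \<omega> j)"
  have prod: "(\<Prod>j\<in>{i..<L}. \<omega> j) = \<omega> i * \<Omega>"
    using i by (simp add: \<Omega>_def prod.atLeast_Suc_lessThan)
  have \<Omega>: "1 \<le> \<Omega>" unfolding \<Omega>_def using omega i by (intro prod_ge_1) auto
  let ?rW = "averaged_residual i r"
  define e f g g' where "e = a (riesz (UI i) r) (riesz (UI i) r)"
    and "f = a (riesz (WD i) ?rW) (riesz (WD i) ?rW)"
    and "g = ?rW (riesz (U (Suc i)) ?rW)" and "g' = ?rW (precond n (Suc i) ?rW)"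
  note two = two_level_bounds[OF i Suc.prems(4), folded e_def]
  have IH: "g \<le> g'" "g' \<le> \<Omega> * g"
    using Suc.IH[OF _ _ _ lin(5)] Suc.prems i by (auto simp: g_def g'_def \<Omega>_def)
  have eq: "r (precond (Suc n) i r) = e + f + g'"
    using precond_split[OF i Suc.prems(2,3,4,4)] by (simp add: e_def f_def g'_def)
  have "riesz (WD i) ?rW \<in> V"
    using riesz(1)[OF test_spaces(6,5)[OF i] subspaces(3)[OF i] lin(4)] test_spaces(5)[OF i] by blast
  then have f: "0 \<le> f" unfolding f_def by (rule form_nonneg)
  have lower: "r (riesz (U i) r) - e \<le> f + g" and upper: "f + g \<le> \<omega> i * (r (riesz (U i) r) - e)"
    using two by (simp_all add: f_def g_def)
  have "e + f + g' \<le> \<Omega> * \<omega> i * e + \<Omega> * (f + g)"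
  proof -
    have "1 * e \<le> \<Omega> * \<omega> i * e" using \<Omega> omega[OF i] two(3) mult_mono[of 1 \<Omega> 1 "\<omega> i"]
      by (intro mult_right_mono) auto
    moreover have "f \<le> \<Omega> * f" using mult_right_mono[OF \<Omega> f] by simp
    ultimately show ?thesis using IH by (simp add: algebra_simps)
  qed
  also have "\<dots> \<le> \<Omega> * \<omega> i * e + \<Omega> * (\<omega> i * (r (riesz (U i) r) - e))"
    using upper \<Omega> by (intro add_left_mono mult_left_mono) auto
  also have "\<dots> = \<omega> i * \<Omega> * r (riesz (U i) r)" by (simp add: algebra_simps)
  finally show ?case
    unfolding eq prod using lower IH(1) by simp
qed

text \<open>
  For \<open>r = a u\<close> the exact solution is \<open>u\<close>, so the bounds on \<open>r (B r)\<close> turn into bounds on the Rayleigh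
  quotient of \<open>B A\<close> in the energy form.
\<close>

lemma preconditioned_operator:
  assumes L: "2 \<le> L"
  defines "T \<equiv> \<lambda>u. precond (L - 1) 1 (a u)"
  shows "u \<in> U 1 \<Longrightarrow> T u \<in> U 1"
    "u \<in> U 1 \<Longrightarrow> v \<in> U 1 \<Longrightarrow> a (T u) v = a u (T v)"
    "u \<in> U 1 \<Longrightarrow> a u u \<le> a (T u) u"
    "u \<in> U 1 \<Longrightarrow> a (T u) u \<le> (\<Prod>j\<in>{1..<L}. \<omega> j) * a u u"
proof -
  have i: "1 \<in> {1..L}" "1 + (L - 1) = L" using L by auto
  note U = U_structure[OF i(1) L]
  have lin: "linear_map_on (U 1) (a u)" if "u \<in> U 1" for u
    using that U(2) by (intro linear_map_on_form) auto
  have V: "x \<in> V" if "x \<in> U 1" for x using that U by auto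
  show T: "T u \<in> U 1" if "u \<in> U 1" for u
    unfolding T_def by (rule precond_in_U[OF i L lin[OF that]])
  show "a (T u) v = a u (T v)" if "u \<in> U 1" "v \<in> U 1" for u v
    using precond_sym[OF i L lin[OF that(1)] lin[OF that(2)]] form_sym[OF V V, OF that(2) T[OF that(1)]]
    by (simp add: T_def)
  have "riesz (U 1) (a u) = u" if "u \<in> U 1" for u
    using riesz_unique[OF U(3,2,1) lin[OF that] that] by simp
  then show "a u u \<le> a (T u) u" "a (T u) u \<le> (\<Prod>j\<in>{1..<L}. \<omega> j) * a u u" if "u \<in> U 1" for u
    using precond_bounds[OF i L lin[OF that]] that form_sym[OF V V, OF that T[OF that]]
    by (simp_all add: T_def)
qed

lemma condition_number_bound:
  assumes L: "2 \<le> L" and "U 1 \<noteq> {0}"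
    and B: "\<And>u. u \<in> U 1 \<Longrightarrow> B u = precond (L - 1) 1 (a u)"
  shows "finite (eigenvalues_on (U 1) B) \<and> eigenvalues_on (U 1) B \<noteq> {} \<and>
    0 < Min (eigenvalues_on (U 1) B) \<and>
    Max (eigenvalues_on (U 1) B) / Min (eigenvalues_on (U 1) B) \<le> (\<Prod>i\<in>{1..<L}. \<omega> i)"
proof -
  have "1 \<in> {1..L}" using L by auto
  note U = U_structure[OF this L]
  note T = preconditioned_operator[OF L]
  let ?S = "eigenvalues_on (U 1) B" and ?\<Omega> = "\<Prod>i\<in>{1..<L}. \<omega> i"
  have BU: "B u \<in> U 1" and B_sym: "a (B u) v = a u (B v)" and B_le: "a (B u) u \<le> ?\<Omega> * a u u"
    if "u \<in> U 1" "v \<in> U 1" for u v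
    using that T by (simp_all add: B)
  have fin: "finite ?S"
    by (rule finite_eigenvalues_self_adjoint[OF U BU B_sym])
  have ne: "?S \<noteq> {}"
    using self_adjoint_has_eigenvector[OF U assms(2) BU B_sym B_le]
    by (auto simp: eigenvalues_on_def)
  have bounds: "1 \<le> l \<and> l \<le> ?\<Omega>" if "l \<in> ?S" for l
  proof -
    obtain u where u: "u \<in> U 1" "u \<noteq> 0" "precond (L - 1) 1 (a u) = l *\<^sub>R u"
      using \<open>l \<in> ?S\<close> by (auto simp: eigenvalues_on_def B)
    have "0 < a u u" "u \<in> V" using U u by (auto simp: posdef_def)
    then show ?thesis using T(3,4)[OF u(1)] unfolding u(3) by (simp add: form_simps)
  qed
  have M: "Max ?S \<in> ?S" "Min ?S \<in> ?S" using Max_in[OF fin ne] Min_in[OF fin ne] by auto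
  have "Max ?S \<le> ?\<Omega> * Min ?S"
    using bounds[OF M(1)] bounds[OF M(2)] mult_mono[of "Max ?S" ?\<Omega> 1 "Min ?S"] by simp
  moreover have "0 < Min ?S" using bounds[OF M(2)] by linarith
  ultimately show ?thesis
    using fin ne by (simp only: pos_divide_le_eq simp_thms)
qed

end

section \<open>The hierarchy of levels\<close>

lemma component_linear [simp]:
  "component H i s 0 = 0" "component H i s (u + v) = component H i s u + component H i s v"
  "component H i s (c *\<^sub>R u) = c *\<^sub>R component H i s u"
  by (auto simp: component_def scaleR_fun_def fun_eq_iff)

lemma component_W_loc: "w \<in> W_loc H i s \<Longrightarrow> component H i s w = w"
  by (cases "(H, i, s)" rule: W_loc.cases) auto

lemma field_linear [simp]:
  fixes u v :: "'d::finite field"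
  shows "(c *\<^sub>R u) s = c *\<^sub>R u s" "(c *\<^sub>R u s) x = c * u s x"
  by (simp_all add: scaleR_fun_def)

text \<open>
  Most spaces of the hierarchy are cut out of a larger one by the vanishing of degrees of freedom or
  of differences of degrees of freedom.
\<close>

lemma subspace_kernel:
  assumes S: "subspace S" and lin: "\<And>f. f \<in> \<Phi> \<Longrightarrow> linear_map_on S f"
  shows "subspace {w \<in> S. \<forall>f\<in>\<Phi>. f w = (0 :: real)}"
proof (rule subspaceI)
  have "f 0 = 0" if "f \<in> \<Phi>" for f
    using lin[OF that] subspace_0[OF S] unfolding linear_map_on_def
    by (metis scale_zero_left)
  then show "0 \<in> {w \<in> S. \<forall>f\<in>\<Phi>. f w = 0}" using subspace_0[OF S] by blast
  fix x y c assume x: "x \<in> {w \<in> S. \<forall>f\<in>\<Phi>. f w = 0}" and y: "y \<in> {w \<in> S. \<forall>f\<in>\<Phi>. f w = 0}"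
  have "f (x + y) = 0" "f (c *\<^sub>R x) = 0" if "f \<in> \<Phi>" for f
  proof -
    have "f x = 0" "f y = 0" "x \<in> S" "y \<in> S" using x y that by auto
    then show "f (x + y) = 0" "f (c *\<^sub>R x) = 0"
      using lin[OF that] by (simp_all add: linear_map_on_def)
  qed
  then show "x + y \<in> {w \<in> S. \<forall>f\<in>\<Phi>. f w = 0}" "c *\<^sub>R x \<in> {w \<in> S. \<forall>f\<in>\<Phi>. f w = 0}"
    using x y S by (auto simp: subspace_add subspace_scale)
qed

lemma linear_map_on_diff:
  assumes "linear_map_on S f" "subspace S" "x \<in> S" "y \<in> S"
  shows "f (x - y) = f x - f y"
proof -
  have "f ((x - y) + y) = f (x - y) + f y"
    using assms subspace_diff unfolding linear_map_on_def by blast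
  then show ?thesis by simp
qed

lemma restrict_dual:
  assumes "subspace S" "linear_map_on S f"
  shows "restrict f S \<in> dual S"
  using assms unfolding dual_def linear_map_on_def
  by (simp add: subspace_add subspace_scale)

lemma linear_map_on_minus:
  assumes "linear_map_on S f" "linear_map_on S g"
  shows "linear_map_on S (\<lambda>x. f x - g x :: real)"
  using assms by (simp add: linear_map_on_def right_diff_distrib)

locale bddc_hierarchy =
  fixes H :: "('d::finite) hierarchy"
  assumes setting: "bddc_setting H"
begin

abbreviation "L \<equiv> levels H"

lemma levels_ge_2: "2 \<le> L" "1 \<in> {1..<L}" "Suc 0 \<in> {1..<L}"
  using setting by (auto simp: bddc_setting_def)

lemma levelD:
  assumes "i \<in> {1..<L}"
  shows "agglomeration H i"
    "k \<in> cdofs H i \<Longrightarrow> s \<in> {1..num H i} \<Longrightarrow> relevant H i k s \<Longrightarrow>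
       linear_map_on (W_loc H i s) (cfun H i k s)"
    "posdef_on H (W_tilde H i)" "linear_projection_onto (W_tilde H i) (U_space H i) (avg H i)"
  using setting assms unfolding bddc_setting_def by blast+

lemma agg_subset:
  assumes "i \<in> {1..<L}" "s \<in> {1..num H i}"
  shows "agg H i s \<subseteq> {1..num H (i - 1)}"
  using levelD(1)[OF assms(1)] assms(2) unfolding agglomeration_def by blast

lemma element: "t \<in> {1..num H 0} \<Longrightarrow> P1_element (elt H t) \<or> Q1_element (elt H t)"
  using setting unfolding bddc_setting_def conforming_mesh_def by blast

lemma agg_level_1: "s \<in> {1..num H 1} \<Longrightarrow> t \<in> agg H 1 s \<Longrightarrow> t \<in> {1..num H 0}"
  using agg_subset[OF levels_ge_2(2), of s] by auto

section \<open>The form is an energy form on the level 1 functions\<close>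

definition piecewise_shapes :: "'d field set" where
  "piecewise_shapes = {w. \<forall>s\<in>{1..num H 1}. \<forall>t\<in>agg H 1 s. w s \<in> shapes (elt H t)}"

text \<open>
  The null set \<open>N\<close> collects the parts of the elements where gradients are not controlled, and it works for
  all functions at once. This is what makes \<open>grad\<close> additive almost everywhere.
\<close>

lemma gradients_almost_everywhere:
  assumes s: "s \<in> {1..num H 1}"
  obtains N where "negligible N"
    "\<And>x w. x \<in> Om H 1 s - N \<Longrightarrow> w \<in> piecewise_shapes \<Longrightarrow> w s differentiable (at x)"
    "\<And>u v. u \<in> piecewise_shapes \<Longrightarrow> v \<in> piecewise_shapes \<Longrightarrow>
       (\<lambda>x. grad (u s) x \<bullet> grad (v s) x) integrable_on Om H 1 s"
proof -
  let ?A = "agg H 1 s"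
  have fin: "finite ?A" using agg_level_1[OF s] by (meson finite_atLeastAtMost finite_subset subsetI)
  have "\<forall>t\<in>?A. \<exists>G. compact (cell (elt H t)) \<and> negligible (cell (elt H t) - G) \<and>
      (\<forall>v\<in>shapes (elt H t). regular_gradient (cell (elt H t)) G v)"
    using element_regular_gradient[OF element[OF agg_level_1[OF s]]] by blast
  from bchoice[OF this] obtain G where G: "\<And>t. t \<in> ?A \<Longrightarrow> compact (cell (elt H t))"
    "\<And>t. t \<in> ?A \<Longrightarrow> negligible (cell (elt H t) - G t)"
    "\<And>t v. t \<in> ?A \<Longrightarrow> v \<in> shapes (elt H t) \<Longrightarrow> regular_gradient (cell (elt H t)) (G t) v"
    by blast
  have Om: "Om H 1 s = (\<Union>t\<in>?A. cell (elt H t))" by simp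
  have sh: "w s \<in> shapes (elt H t)" if "w \<in> piecewise_shapes" "t \<in> ?A" for w t
    using that s by (auto simp: piecewise_shapes_def)
  define N where "N = (\<Union>t\<in>?A. cell (elt H t) - G t)"
  show thesis
  proof (rule that[of N])
    show "negligible N" unfolding N_def using fin G(2) by (intro negligible_Union) auto
    show "w s differentiable (at x)" if x: "x \<in> Om H 1 s - N" and w: "w \<in> piecewise_shapes" for x w
    proof -
      obtain t where t: "t \<in> ?A" "x \<in> G t" using x unfolding Om N_def by blast
      then show ?thesis using G(3)[OF t(1) sh[OF w t(1)]] by (auto simp: regular_gradient_def)
    qed
    fix u v assume uv: "u \<in> piecewise_shapes" "v \<in> piecewise_shapes"
    have int: "(\<lambda>x. grad (u s) x \<bullet> grad (v s) x) absolutely_integrable_on cell (elt H t)"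
      if "t \<in> ?A" for t
      by (rule grad_inner_absolutely_integrable[OF G(1,2)[OF that] G(3)[OF that sh[OF uv(1) that]]
            G(3)[OF that sh[OF uv(2) that]]])
    have "(\<lambda>x. grad (u s) x \<bullet> grad (v s) x) absolutely_integrable_on (\<Union>t\<in>B. cell (elt H t))"
      if "B \<subseteq> ?A" for B
      using finite_subset[OF that fin] that
    proof (induction B rule: finite_induct)
      case (insert t B)
      then have "t \<in> ?A" by blast
      with insert show ?case by (simp add: absolutely_integrable_Un int)
    qed simp
    then show "(\<lambda>x. grad (u s) x \<bullet> grad (v s) x) integrable_on Om H 1 s"
      unfolding Om by (auto simp: absolutely_integrable_on_def)
  qed
qed

lemma form_bilinear:
  assumes "u \<in> piecewise_shapes" "v \<in> piecewise_shapes" "w \<in> piecewise_shapes"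
  shows "form H (u + v) w = form H u w + form H v w" "form H (c *\<^sub>R u) w = c * form H u w"
proof -
  have "integral (Om H 1 s) (\<lambda>x. grad ((u + v) s) x \<bullet> grad (w s) x) =
        integral (Om H 1 s) (\<lambda>x. grad (u s) x \<bullet> grad (w s) x) +
        integral (Om H 1 s) (\<lambda>x. grad (v s) x \<bullet> grad (w s) x)"
    "integral (Om H 1 s) (\<lambda>x. grad ((c *\<^sub>R u) s) x \<bullet> grad (w s) x) =
        c * integral (Om H 1 s) (\<lambda>x. grad (u s) x \<bullet> grad (w s) x)"
    if s: "s \<in> {1..num H 1}" for s
  proof -
    obtain N where N: "negligible N"
      "\<And>x w. x \<in> Om H 1 s - N \<Longrightarrow> w \<in> piecewise_shapes \<Longrightarrow> w s differentiable (at x)"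
      "\<And>u v. u \<in> piecewise_shapes \<Longrightarrow> v \<in> piecewise_shapes \<Longrightarrow>
         (\<lambda>x. grad (u s) x \<bullet> grad (v s) x) integrable_on Om H 1 s"
      using gradients_almost_everywhere[OF s] by blast
    have "integral (Om H 1 s) (\<lambda>x. grad ((u + v) s) x \<bullet> grad (w s) x) =
        integral (Om H 1 s) (\<lambda>x. grad (u s) x \<bullet> grad (w s) x + grad (v s) x \<bullet> grad (w s) x)"
      using N(2) assms
      by (intro integral_spike[OF N(1)]) (simp add: grad_add inner_add_left)
    then show "integral (Om H 1 s) (\<lambda>x. grad ((u + v) s) x \<bullet> grad (w s) x) =
        integral (Om H 1 s) (\<lambda>x. grad (u s) x \<bullet> grad (w s) x) +
        integral (Om H 1 s) (\<lambda>x. grad (v s) x \<bullet> grad (w s) x)"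
      using N(3) assms by (simp add: integral_add)
    have "integral (Om H 1 s) (\<lambda>x. grad ((c *\<^sub>R u) s) x \<bullet> grad (w s) x) =
        integral (Om H 1 s) (\<lambda>x. c * (grad (u s) x \<bullet> grad (w s) x))"
      using N(2) assms
      by (intro integral_spike[OF N(1)]) (simp add: grad_scaleR)
    then show "integral (Om H 1 s) (\<lambda>x. grad ((c *\<^sub>R u) s) x \<bullet> grad (w s) x) =
        c * integral (Om H 1 s) (\<lambda>x. grad (u s) x \<bullet> grad (w s) x)"
      by simp
  qed
  then show "form H (u + v) w = form H u w + form H v w" "form H (c *\<^sub>R u) w = c * form H u w"
    unfolding form_def by (simp_all add: sum.distrib sum_distrib_left)
qed

lemma form_commute: "form H u v = form H v u"
  unfolding form_def by (simp add: inner_commute)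

lemma form_self_nonneg:
  assumes "w \<in> piecewise_shapes"
  shows "0 \<le> form H w w"
  unfolding form_def
proof (intro sum_nonneg integral_nonneg)
  fix s assume "s \<in> {1..num H 1}"
  then show "(\<lambda>x. grad (w s) x \<bullet> grad (w s) x) integrable_on Om H 1 s"
    using gradients_almost_everywhere assms by metis
qed simp

definition W1 :: "'d field set" where "W1 = W_space H 1"

lemma mem_W_loc_1:
  "w \<in> W_loc H 1 s \<longleftrightarrow> component H 1 s w = w \<and>
     (\<forall>x. x \<notin> Om H 1 s \<longrightarrow> w s x = 0) \<and> (\<forall>t\<in>agg H 1 s. w s \<in> shapes (elt H t)) \<and>
     (\<forall>k\<in>{1..nnodes H}. node H k \<in> Om H 1 s \<inter> frontier (region H) \<longrightarrow> w s (node H k) = 0)"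
  unfolding One_nat_def W_loc.simps by blast

lemma component_1 [simp]: "component H (Suc 0) s w s = w s"
  by (simp add: component_def)

lemma W1_piecewise_shapes: "W1 \<subseteq> piecewise_shapes"
proof
  fix w assume "w \<in> W1"
  then have "component H 1 s w \<in> W_loc H 1 s" if "s \<in> {1..num H 1}" for s
    using that by (simp add: W1_def W_space_def)
  then show "w \<in> piecewise_shapes"
    unfolding mem_W_loc_1 piecewise_shapes_def by simp
qed

lemma subspace_W_loc_1:
  assumes s: "s \<in> {1..num H 1}"
  shows "subspace (W_loc H 1 s)"
proof -
  have sub: "subspace (shapes (elt H t))" if "t \<in> agg H 1 s" for t
    by (rule subspace_shapes[OF element[OF agg_level_1[OF s that]]])
  show ?thesis
    by (rule subspaceI; unfold mem_W_loc_1)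
      (auto simp: sub subspace_0 subspace_add subspace_scale)
qed

lemma subspace_W_space:
  assumes "\<And>s. s \<in> {1..num H i} \<Longrightarrow> subspace (W_loc H i s)"
  shows "subspace (W_space H i)"
  by (rule subspaceI; unfold W_space_def)
    (auto simp: assms subspace_0 subspace_add subspace_scale)

text \<open>
  A function in \<open>W1\<close> is determined by its values at the nodes of every element in every substructure:
  they determine it on each element, and it is zero off its substructures.
\<close>

lemma fin_dim_W1: "fin_dim W1"
proof (rule fin_dim_if_separated)
  let ?X = "{1..num H 1} \<times> (\<Union>t\<in>{1..num H 0}. nodes (elt H t))"
  show "finite ?X" using finite_nodes[OF element] by auto
  show "subspace W1" unfolding W1_def by (intro subspace_W_space subspace_W_loc_1)
  show "linear_map_on W1 (\<lambda>w. case p of (s, x) \<Rightarrow> w s x)" for p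
    by (cases p) (simp add: linear_map_on_def)
  fix w assume w: "w \<in> W1" and zero: "\<And>p. p \<in> ?X \<Longrightarrow> (case p of (s, x) \<Rightarrow> w s x) = 0"
  have "w s x = 0" for s x
  proof (cases "s \<in> {1..num H 1}")
    case True
    then have "component H 1 s w \<in> W_loc H 1 s" using w by (simp add: W1_def W_space_def)
    then have out: "x \<notin> Om H 1 s \<Longrightarrow> w s x = 0" and sh: "\<And>t. t \<in> agg H 1 s \<Longrightarrow> w s \<in> shapes (elt H t)"
      unfolding mem_W_loc_1 by simp_all
    show ?thesis
    proof (cases "x \<in> Om H 1 s")
      case x: True
      then obtain t where t: "t \<in> agg H 1 s" "x \<in> cell (elt H t)" by auto
      have t0: "t \<in> {1..num H 0}" by (rule agg_level_1[OF True t(1)])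
      show ?thesis
      proof (rule shape_zero_at_nodes[OF element[OF t0] sh[OF t(1)] _ t(2)])
        fix y assume "y \<in> nodes (elt H t)"
        then have "(s, y) \<in> ?X" using t0 True by blast
        from zero[OF this] show "w s y = 0" by simp
      qed
    qed (use out in auto)
  next
    case False
    then show ?thesis using w by (simp add: W1_def W_space_def)
  qed
  then show "w = 0" by (auto simp: fun_eq_iff)
qed

sublocale energy_form W1 "form H"
proof
  show "subspace W1" unfolding W1_def by (intro subspace_W_space subspace_W_loc_1)
  show "fin_dim W1" by (rule fin_dim_W1)
  fix x y z c assume "x \<in> W1" "y \<in> W1" "z \<in> W1"
  then have "x \<in> piecewise_shapes" "y \<in> piecewise_shapes" "z \<in> piecewise_shapes"
    using W1_piecewise_shapes by auto
  from form_bilinear[OF this] form_self_nonneg[OF this(1)] form_commute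
  show "form H (x + y) z = form H x z + form H y z" "form H (c *\<^sub>R x) z = c * form H x z"
    "form H x y = form H y x" "0 \<le> form H x x" by auto
qed

lemma posdef_on_iff: "posdef_on H S \<longleftrightarrow> posdef S"
  by (simp add: posdef_on_def posdef_def)

section \<open>The spaces of the higher levels\<close>

text \<open>
  Because of this, a function composed of its parts on the level \<open>i\<close> substructures is also composed of
  its parts on the level 1 substructures, so that all spaces lie in \<open>W1\<close>.
\<close>

lemma leaves_cover: "Suc i \<in> {1..<L} \<Longrightarrow> (\<Union>s\<in>{1..num H (Suc i)}. leaves H (Suc i) s) = {1..num H 1}"
proof (induction i)
  case (Suc i)
  have A: "(\<Union>s\<in>{1..num H (Suc (Suc i))}. agg H (Suc (Suc i)) s) = {1..num H (Suc i)}"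
    using levelD(1)[OF Suc.prems] by (simp add: agglomeration_def)
  have "(\<Union>s\<in>{1..num H (Suc (Suc i))}. leaves H (Suc (Suc i)) s) =
      (\<Union>t\<in>(\<Union>s\<in>{1..num H (Suc (Suc i))}. agg H (Suc (Suc i)) s). leaves H (Suc i) t)"
    by auto
  then show ?case unfolding A using Suc by auto
qed simp

lemma component_component:
  "i \<in> leaves H j t \<Longrightarrow> component H 1 i (component H j t w) = component H 1 i w"
  by (auto simp: component_def fun_eq_iff)

lemma cdof_linear:
  assumes "i \<in> {1..<L}" "k \<in> cdofs H i" "s \<in> {1..num H i}" "relevant H i k s"
    and "\<And>w. w \<in> S \<Longrightarrow> component H i s w \<in> W_loc H i s"
  shows "linear_map_on S (cdof H i k s)"
  using levelD(2)[OF assms(1-4)] assms(5) by (simp add: cdof_def linear_map_on_def)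

lemma min_energy_eq_orthogonal:
  assumes S: "S \<subseteq> W1" "subspace S" and K: "K \<subseteq> S" "subspace K"
    and same: "\<And>w z. w \<in> S \<Longrightarrow> z \<in> S \<Longrightarrow> same z w \<longleftrightarrow> z - w \<in> K"
  shows "min_energy H S same = {w \<in> S. \<forall>z\<in>K. form H w z = 0}"
  using minimal_energy_iff_orthogonal[OF S K same]
  by (auto simp: min_energy_def energy_def)

lemma subspace_min_energy_W_loc:
  assumes i: "i \<in> {1..<L}" and s: "s \<in> {1..num H i}"
    and W: "subspace (W_loc H i s)" "W_loc H i s \<subseteq> W1"
  shows "subspace (min_energy H (W_loc H i s) (same_cdofs_on H i s))"
proof -
  define \<Phi> where "\<Phi> = (\<lambda>k. cdof H i k s) ` {k \<in> cdofs H i. relevant H i k s}"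
  define K where "K = {w \<in> W_loc H i s. \<forall>f\<in>\<Phi>. f w = 0}"
  have lin: "linear_map_on (W_loc H i s) f" if "f \<in> \<Phi>" for f
    using that by (auto simp: \<Phi>_def component_W_loc intro!: cdof_linear[OF i _ s])
  have K: "K \<subseteq> W_loc H i s" "subspace K"
    using subspace_kernel[OF W(1) lin] by (auto simp: K_def)
  have "same_cdofs_on H i s z w \<longleftrightarrow> z - w \<in> K" if "w \<in> W_loc H i s" "z \<in> W_loc H i s" for w z
  proof -
    have "same_cdofs_on H i s z w \<longleftrightarrow> (\<forall>f\<in>\<Phi>. f z = f w)"
      by (auto simp: same_cdofs_on_def \<Phi>_def)
    also have "\<dots> \<longleftrightarrow> (\<forall>f\<in>\<Phi>. f (z - w) = 0)"
    proof (intro ball_cong refl)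
      fix f assume "f \<in> \<Phi>"
      from linear_map_on_diff[OF lin[OF this] W(1) that(2,1)] show "f z = f w \<longleftrightarrow> f (z - w) = 0"
        by simp
    qed
    also have "\<dots> \<longleftrightarrow> z - w \<in> K"
      using that by (simp add: K_def subspace_diff[OF W(1)])
    finally show ?thesis .
  qed
  then show ?thesis
    using min_energy_eq_orthogonal[OF W(2,1) K] subspace_orthogonal[OF W(2,1)] K(1) W(2) by auto
qed

text \<open>
  Both claims are proved together, level by level: minimal energy is a linear condition only if the
  form is an energy form on the local spaces one level below, that is, if they are
  subspaces of \<open>W1\<close>.
\<close>

lemma W_loc_structure:
  "Suc i \<in> {1..<L} \<Longrightarrow> s \<in> {1..num H (Suc i)} \<Longrightarrow>
    subspace (W_loc H (Suc i) s) \<and> W_loc H (Suc i) s \<subseteq> W1"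
proof (induction i arbitrary: s)
  case 0
  then have s: "s \<in> {1..num H 1}" by simp
  have "w \<in> W1" if w: "w \<in> W_loc H 1 s" for w
  proof -
    have c: "component H 1 s w = w" using component_W_loc[OF w] .
    have "component H 1 s' w \<in> W_loc H 1 s'" if s': "s' \<in> {1..num H 1}" for s'
    proof (cases "s' = s")
      case False
      then have "component H 1 s' w = 0"
        by (subst c[symmetric]) (auto simp: component_def fun_eq_iff)
      then show ?thesis using subspace_0[OF subspace_W_loc_1[OF s']] by simp
    qed (use c w in auto)
    moreover have "w t = 0" if "t \<notin> {1..num H 1}" for t
      using s that by (subst c[symmetric]) (auto simp: component_def)
    ultimately show ?thesis by (simp add: W1_def W_space_def)
  qed
  then show ?case using subspace_W_loc_1[OF s] by auto
next
  case (Suc i)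
  let ?j = "Suc i" and ?A = "agg H (Suc (Suc i)) s"
  have j: "?j \<in> {1..<L}" using Suc.prems by auto
  have A: "t \<in> {1..num H ?j}" if "t \<in> ?A" for t
    using agg_subset[OF Suc.prems] that by auto
  note IH = Suc.IH[OF j A]
  \<comment> \<open>Degrees of freedom are linear on functions whose parts lie in the local spaces of level \<open>?j\<close>; \<open>S\<close> collects them before the continuity and boundary conditions are imposed.\<close>
  define S where "S = {w. component H (Suc ?j) s w = w \<and>
    (\<forall>t\<in>?A. component H ?j t w \<in> min_energy H (W_loc H ?j t) (same_cdofs_on H ?j t))}"
  have "subspace S"
  proof -
    have "subspace (min_energy H (W_loc H ?j t) (same_cdofs_on H ?j t))" if "t \<in> ?A" for t
      using subspace_min_energy_W_loc[OF j A[OF that]] IH[OF that] by blast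
    then show ?thesis
      by (intro subspaceI) (auto simp: S_def subspace_0 subspace_add subspace_scale)
  qed
  have comp: "component H ?j t w \<in> W_loc H ?j t" if "w \<in> S" "t \<in> ?A" for w t
    using that by (auto simp: S_def min_energy_def)
  have cdof: "linear_map_on S (cdof H ?j k t)" if "k \<in> cdofs H ?j" "t \<in> ?A" "relevant H ?j k t" for k t
    using cdof_linear[OF j that(1) A[OF that(2)] that(3)] comp that(2) by blast
  define \<Phi> where "\<Phi> =
    (\<lambda>(k, t, t') w. cdof H ?j k t w - cdof H ?j k t' w) ` {(k, t, t'). k \<in> cdofs H ?j \<and> t \<in> ?A \<and>
       t' \<in> ?A \<and> relevant H ?j k t \<and> relevant H ?j k t'} \<union>
    (\<lambda>(k, t). cdof H ?j k t) `
      {(k, t). k \<in> cdofs H ?j \<and> t \<in> ?A \<and> relevant H ?j k t \<and> on_boundary H ?j k}"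
  have "W_loc H (Suc ?j) s = {w \<in> S. \<forall>f\<in>\<Phi>. f w = 0}"
  proof (rule set_eqI)
    fix w
    have "(\<forall>f\<in>\<Phi>. f w = 0) \<longleftrightarrow>
       (\<forall>k\<in>cdofs H ?j. \<forall>t\<in>?A. \<forall>t'\<in>?A.
          relevant H ?j k t \<and> relevant H ?j k t' \<longrightarrow> cdof H ?j k t w = cdof H ?j k t' w) \<and>
       (\<forall>k\<in>cdofs H ?j. \<forall>t\<in>?A. relevant H ?j k t \<and> on_boundary H ?j k \<longrightarrow> cdof H ?j k t w = 0)"
      by (simp add: \<Phi>_def ball_Un) blast
    then show "w \<in> W_loc H (Suc ?j) s \<longleftrightarrow> w \<in> {w \<in> S. \<forall>f\<in>\<Phi>. f w = 0}"
      unfolding W_loc.simps S_def mem_Collect_eq by argo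
  qed
  moreover have "linear_map_on S f" if "f \<in> \<Phi>" for f
    using that by (auto simp: \<Phi>_def intro!: linear_map_on_minus cdof)
  ultimately have "subspace (W_loc H (Suc ?j) s)" "W_loc H (Suc ?j) s \<subseteq> S"
    using subspace_kernel[OF \<open>subspace S\<close>] by auto
  moreover have "w \<in> W1" if w: "w \<in> S" for w
  proof -
    have c: "component H (Suc ?j) s w = w" using w by (simp add: S_def)
    have "component H 1 s' w \<in> W_loc H 1 s'" if s': "s' \<in> {1..num H 1}" for s'
    proof (cases "s' \<in> leaves H (Suc ?j) s")
      case True
      then obtain t where t: "t \<in> ?A" "s' \<in> leaves H ?j t" by auto
      then have "component H ?j t w \<in> W1" using IH[OF t(1)] comp[OF w t(1)] by blast
      then have "component H 1 s' (component H ?j t w) \<in> W_loc H 1 s'"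
        using s' unfolding W1_def W_space_def by blast
      then show ?thesis by (simp only: component_component[OF t(2)])
    next
      case False
      then have "component H 1 s' w = 0"
        by (subst c[symmetric]) (auto simp: component_def fun_eq_iff)
      then show ?thesis using subspace_0[OF subspace_W_loc_1[OF s']] by simp
    qed
    moreover have "w t = 0" if t: "t \<notin> {1..num H 1}" for t
    proof -
      have "t \<notin> leaves H (Suc ?j) s" using leaves_cover[OF Suc.prems(1)] Suc.prems(2) t by blast
      then show ?thesis by (subst c[symmetric]) (simp add: component_def)
    qed
    ultimately show ?thesis by (simp add: W1_def W_space_def)
  qed
  ultimately show ?case by blast
qed

lemma W_loc_level:
  assumes "i \<in> {1..<L}" "s \<in> {1..num H i}"
  shows "subspace (W_loc H i s)" "W_loc H i s \<subseteq> W1"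
  using W_loc_structure[of "i - 1" s] assms by auto

lemma W_space_level:
  assumes i: "i \<in> {1..<L}"
  shows "subspace (W_space H i)" "W_space H i \<subseteq> W1"
proof -
  show "subspace (W_space H i)" by (rule subspace_W_space) (rule W_loc_level(1)[OF i])
  show "W_space H i \<subseteq> W1"
  proof
    fix w assume w: "w \<in> W_space H i"
    have "component H 1 t w \<in> W_loc H 1 t" if t: "t \<in> {1..num H 1}" for t
    proof -
      have "t \<in> (\<Union>s\<in>{1..num H i}. leaves H i s)"
        using leaves_cover[of "i - 1"] i t by auto
      then obtain s where s: "s \<in> {1..num H i}" "t \<in> leaves H i s" by blast
      then have "component H i s w \<in> W1"
        using w W_loc_level(2)[OF i s(1)] by (auto simp: W_space_def)
      then have "component H 1 t (component H i s w) \<in> W_loc H 1 t"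
        using t unfolding W1_def W_space_def by blast
      then show ?thesis by (simp only: component_component[OF s(2)])
    qed
    then show "w \<in> W1" using w by (simp add: W1_def W_space_def)
  qed
qed

lemma cdof_linear_W_space:
  assumes "i \<in> {1..<L}" "k \<in> cdofs H i" "s \<in> {1..num H i}" "relevant H i k s" "S \<subseteq> W_space H i"
  shows "linear_map_on S (cdof H i k s)"
  using assms(3,5) by (intro cdof_linear[OF assms(1-4)]) (auto simp: W_space_def)

lemma W_Delta_level:
  assumes i: "i \<in> {1..<L}"
  shows "subspace (W_Delta H i)" "W_Delta H i \<subseteq> W_tilde H i"
proof -
  define \<Phi> where "\<Phi> = (\<lambda>(k, s). cdof H i k s) `
    {(k, s). k \<in> cdofs H i \<and> s \<in> {1..num H i} \<and> relevant H i k s}"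
  have "W_Delta H i = {w \<in> W_space H i. \<forall>f\<in>\<Phi>. f w = 0}"
    unfolding W_Delta_def \<Phi>_def by auto
  moreover have "linear_map_on (W_space H i) f" if "f \<in> \<Phi>" for f
    using that by (auto simp del: atLeastAtMost_iff simp: \<Phi>_def intro!: cdof_linear_W_space[OF i])
  ultimately show "subspace (W_Delta H i)"
    using subspace_kernel[OF W_space_level(1)[OF i], of \<Phi>] by simp
  show "W_Delta H i \<subseteq> W_tilde H i"
    by (auto simp: W_Delta_def W_tilde_def)
qed

lemma W_tilde_level:
  assumes i: "i \<in> {1..<L}"
  shows "subspace (W_tilde H i)" "W_tilde H i \<subseteq> W_space H i" "W_tilde H i \<subseteq> W1"
proof -
  let ?N = "{1..num H i}"
  define \<Phi> where "\<Phi> =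
    (\<lambda>(k, s, s') w. cdof H i k s w - cdof H i k s' w) ` {(k, s, s'). k \<in> cdofs H i \<and> s \<in> ?N \<and>
       s' \<in> ?N \<and> relevant H i k s \<and> relevant H i k s'} \<union>
    (\<lambda>(k, s). cdof H i k s) `
      {(k, s). k \<in> cdofs H i \<and> s \<in> ?N \<and> relevant H i k s \<and> on_boundary H i k}"
  have "W_tilde H i = {w \<in> W_space H i. \<forall>f\<in>\<Phi>. f w = 0}"
  proof (rule set_eqI)
    fix w
    have "(\<forall>f\<in>\<Phi>. f w = 0) \<longleftrightarrow>
       (\<forall>k\<in>cdofs H i. \<forall>s\<in>?N. \<forall>s'\<in>?N.
          relevant H i k s \<and> relevant H i k s' \<longrightarrow> cdof H i k s w = cdof H i k s' w) \<and>
       (\<forall>k\<in>cdofs H i. \<forall>s\<in>?N. relevant H i k s \<and> on_boundary H i k \<longrightarrow> cdof H i k s w = 0)"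
      by (simp del: atLeastAtMost_iff add: \<Phi>_def ball_Un) blast
    then show "w \<in> W_tilde H i \<longleftrightarrow> w \<in> {w \<in> W_space H i. \<forall>f\<in>\<Phi>. f w = 0}"
      unfolding W_tilde_def mem_Collect_eq by argo
  qed
  moreover have "linear_map_on (W_space H i) f" if "f \<in> \<Phi>" for f
    using that by (auto simp del: atLeastAtMost_iff simp: \<Phi>_def
        intro!: linear_map_on_minus cdof_linear_W_space[OF i])
  ultimately show "subspace (W_tilde H i)"
    using subspace_kernel[OF W_space_level(1)[OF i], of \<Phi>] by simp
  show "W_tilde H i \<subseteq> W_space H i" by (auto simp: W_tilde_def)
  then show "W_tilde H i \<subseteq> W1" using W_space_level(2)[OF i] by blast
qed

text \<open>
  Within \<open>W_tilde\<close>, two functions have the same coarse degrees of freedom exactly if they differ by an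
  element of \<open>W_Delta\<close>.
\<close>

lemma W_Pi_eq:
  assumes i: "i \<in> {1..<L}"
  shows "W_Pi H i = {w \<in> W_tilde H i. \<forall>z\<in>W_Delta H i. form H w z = 0}"
  unfolding W_Pi_def
proof (rule min_energy_eq_orthogonal)
  note W = W_tilde_level[OF i] and D = W_Delta_level[OF i]
  show "W_tilde H i \<subseteq> W1" "subspace (W_tilde H i)" "W_Delta H i \<subseteq> W_tilde H i"
    "subspace (W_Delta H i)"
    using W D by auto
  fix w z assume wz: "w \<in> W_tilde H i" "z \<in> W_tilde H i"
  have d: "cdof H i k s (z - w) = cdof H i k s z - cdof H i k s w"
    if "k \<in> cdofs H i" "s \<in> {1..num H i}" "relevant H i k s" for k s
    using linear_map_on_diff[OF cdof_linear_W_space[OF i that W(2)] W(1)] wz by blast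
  have "z - w \<in> W_space H i" using wz W(1,2) by (auto intro: subspace_diff)
  then show "(\<forall>s\<in>{1..num H i}. same_cdofs_on H i s z w) \<longleftrightarrow> z - w \<in> W_Delta H i"
    by (auto simp del: atLeastAtMost_iff simp: W_Delta_def same_cdofs_on_def d)
qed

lemma U_space_Suc: "i \<in> {1..<L} \<Longrightarrow> U_space H (Suc i) = W_Pi H i"
  by (simp add: U_space_def)

lemma subspace_U_space:
  assumes i: "i \<in> {1..<L}"
  shows "subspace (U_space H i)"
proof (cases "i = 1")
  case True
  have W: "subspace (W_space H 1)" by (rule W_space_level(1)[OF levels_ge_2(2)])
  \<comment> \<open>Continuity is written with a difference, which is linear in \<open>w\<close>.\<close>
  define C where "C = {w :: 'd field. \<forall>s\<in>{1..num H 1}. \<forall>s'\<in>{1..num H 1}.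
    \<forall>x\<in>Om H 1 s \<inter> Om H 1 s'. w s x - w s' x = 0}"
  have "U_space H 1 = W_space H 1 \<inter> C"
    by (simp only: U_space_def C_def order_refl if_True right_minus_eq Int_def mem_Collect_eq)
  moreover have "subspace C"
  proof (rule subspaceI)
    show "0 \<in> C" by (simp add: C_def del: Om.simps)
    fix u v c assume u: "u \<in> C" and v: "v \<in> C"
    have zero: "w s x - w s' x = 0"
      if "w \<in> C" "s \<in> {1..num H 1}" "s' \<in> {1..num H 1}" "x \<in> Om H 1 s \<inter> Om H 1 s'" for w s s' x
      using that unfolding C_def by blast
    have "(u + v) s x - (u + v) s' x = 0" "(c *\<^sub>R u) s x - (c *\<^sub>R u) s' x = 0"
      if "s \<in> {1..num H 1}" "s' \<in> {1..num H 1}" "x \<in> Om H 1 s \<inter> Om H 1 s'" for s s' x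
    proof -
      note z = zero[OF u that] zero[OF v that]
      have "(u + v) s x - (u + v) s' x = (u s x - u s' x) + (v s x - v s' x)"
        "(c *\<^sub>R u) s x - (c *\<^sub>R u) s' x = c * (u s x - u s' x)"
        by (simp_all add: right_diff_distrib)
      then show "(u + v) s x - (u + v) s' x = 0" "(c *\<^sub>R u) s x - (c *\<^sub>R u) s' x = 0"
        unfolding z by (simp_all only: add_0 mult_zero_right)
    qed
    then show "u + v \<in> C" "c *\<^sub>R u \<in> C"
      unfolding C_def by blast+
  qed
  ultimately show ?thesis using W True by (simp add: subspace_inter)
next
  case False
  then obtain j where j: "i = Suc j" "j \<in> {1..<L}" using i by (cases i) auto
  have D: "W_Delta H j \<subseteq> W1" using W_Delta_level(2)[OF j(2)] W_tilde_level(3)[OF j(2)] by blast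
  show ?thesis
    unfolding j(1) U_space_Suc[OF j(2)] W_Pi_eq[OF j(2)]
    by (rule subspace_orthogonal[OF W_tilde_level(3,1)[OF j(2)] D])
qed

text \<open>
  For \<open>i \<ge> 2\<close> the degree of freedom is evaluated on a chosen element; on functions in \<open>U_space H i\<close> it is
  a coarse degree of freedom of the level below, hence linear.
\<close>

lemma dof_linear:
  assumes i: "i \<in> {1..<L}" and k: "k \<in> dofs H i" "s \<in> {1..num H i}" "carries H i k s"
  shows "linear_map_on (U_space H i) (dof H i k s)"
proof (cases "i = 1")
  case True
  then show ?thesis by (auto simp: dof_def linear_map_on_def)
next
  case False
  then obtain j where j: "i = Suc j" "j \<in> {1..<L}" using i by (cases i) auto
  define t where "t = (SOME t. t \<in> agg H i s \<and> relevant H j k t)"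
  have "\<exists>t. t \<in> agg H i s \<and> relevant H j k t"
    using k(3) j by (auto simp: carries_def)
  then have t: "t \<in> agg H i s" "relevant H j k t"
    unfolding t_def by (metis (mono_tags, lifting) someI_ex)+
  have "t \<in> {1..num H j}" using agg_subset[OF i k(2)] t(1) j(1) by auto
  moreover have "U_space H i \<subseteq> W_space H j"
    using W_Pi_eq[OF j(2)] W_tilde_level(2)[OF j(2)] by (auto simp: j(1) U_space_Suc[OF j(2)])
  moreover have "k \<in> cdofs H j" using k(1) j by (simp add: dofs_def)
  ultimately have "linear_map_on (U_space H i) (cdof H j k t)"
    using t(2) by (intro cdof_linear_W_space[OF j(2)])
  moreover have "dof H i k s = cdof H j k t" using j by (auto simp: dof_def t_def)
  ultimately show ?thesis by simp
qed

lemma U_I_level: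
  assumes i: "i \<in> {1..<L}"
  shows "subspace (U_I H i)" "U_I H i \<subseteq> U_space H i"
proof -
  define \<Phi> where "\<Phi> = (\<lambda>(k, s). dof H i k s) `
    {(k, s). k \<in> Gamma H i \<and> s \<in> {1..num H i} \<and> carries H i k s}"
  have "U_I H i = {w \<in> U_space H i. \<forall>f\<in>\<Phi>. f w = 0}"
    unfolding U_I_def \<Phi>_def by auto
  moreover have "linear_map_on (U_space H i) f" if "f \<in> \<Phi>" for f
    using that by (auto simp del: atLeastAtMost_iff simp: \<Phi>_def Gamma_def intro!: dof_linear[OF i])
  ultimately show "subspace (U_I H i)"
    using subspace_kernel[OF subspace_U_space[OF i], of \<Phi>] by simp
  show "U_I H i \<subseteq> U_space H i" by (auto simp: U_I_def)
qed

lemma P_int_eq_riesz: "P_int H i w = riesz (U_I H i) (form H w)"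
  by (simp add: P_int_def riesz_def)

end

section \<open>The algorithm\<close>

locale bddc_hierarchy_bounded = bddc_hierarchy H for H :: "('d::finite) hierarchy" +
  fixes \<omega> :: "nat \<Rightarrow> real"
  assumes omega_ge_1: "\<forall>i\<in>{1..<levels H}. 1 \<le> \<omega> i"
    and omega_bound: "\<forall>i\<in>{1..<levels H}. \<forall>w\<in>W_tilde H i.
      energy H (avg H i w - P_int H i (avg H i w)) \<le> \<omega> i * energy H w"
begin

sublocale multilevel_spaces W1 "form H" "levels H" "U_space H" "U_I H" "W_Delta H" "W_tilde H" "avg H" \<omega>
proof
  fix i assume i: "i \<in> {1..<levels H}"
  show "subspace (U_space H i)" "subspace (U_I H i)" "subspace (W_Delta H i)" "subspace (W_tilde H i)"
    "U_I H i \<subseteq> U_space H i" "W_Delta H i \<subseteq> W_tilde H i" "W_tilde H i \<subseteq> W1"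
    by (fact subspace_U_space[OF i] U_I_level[OF i] W_Delta_level[OF i] W_tilde_level[OF i])+
  show "posdef (W_tilde H i)" using levelD(3)[OF i] by (simp add: posdef_on_iff)
  show "U_space H (Suc i) = {w \<in> W_tilde H i. \<forall>z\<in>W_Delta H i. form H w z = 0}"
    unfolding U_space_Suc[OF i] by (rule W_Pi_eq[OF i])
  show "linear_projection_onto (W_tilde H i) (U_space H i) (avg H i)" by (rule levelD(4)[OF i])
  show "1 \<le> \<omega> i" using omega_ge_1 i by blast
  fix w assume "w \<in> W_tilde H i"
  then have "energy H (avg H i w - P_int H i (avg H i w)) \<le> \<omega> i * energy H w"
    using omega_bound i by blast
  then show "form H (avg H i w - riesz (U_I H i) (form H (avg H i w)))
      (avg H i w - riesz (U_I H i) (form H (avg H i w))) \<le> \<omega> i * form H w w"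
    by (simp add: energy_def P_int_eq_riesz)
qed

text \<open>
  The defining relations of one level determine its quantities, given the result \<open>c\<close> of the coarser
  level.
\<close>

lemma precond_step:
  assumes i: "i \<in> {1..<L}" and r: "linear_map_on (U_space H i) r"
    and uI: "u_I \<in> U_I H i" "\<forall>z\<in>U_I H i. form H u_I z = r z"
    and rB: "\<forall>v\<in>U_space H i. r_B v = r v - form H u_I v"
  shows "\<forall>z\<in>W_tilde H i. r_B (avg H i z) = averaged_residual i r z"
    and "w_Delta \<in> W_Delta H i \<Longrightarrow> \<forall>z\<in>W_Delta H i. form H w_Delta z = r_B (avg H i z) \<Longrightarrow>
      v_I \<in> U_I H i \<Longrightarrow> \<forall>z\<in>U_I H i. form H v_I z = form H (avg H i (w_Delta + c)) z \<Longrightarrow>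
      c = precond n (Suc i) (averaged_residual i r) \<Longrightarrow> Suc i + n = L \<Longrightarrow>
      u_I + avg H i (w_Delta + c) - v_I = precond (Suc n) i r"
proof -
  note lin = linear_residuals[OF i r]
  have uI_eq: "u_I = riesz (U_I H i) r"
    using uI by (intro riesz_unique[OF test_spaces(4,3)[OF i] subspaces(2)[OF i] lin(1)]) auto
  show av: "\<forall>z\<in>W_tilde H i. r_B (avg H i z) = averaged_residual i r z"
    using rB projectionD(2)[OF i] by (simp add: averaged_residual_def interior_residual_def uI_eq)
  assume w: "w_Delta \<in> W_Delta H i" "\<forall>z\<in>W_Delta H i. form H w_Delta z = r_B (avg H i z)"
    and v: "v_I \<in> U_I H i" "\<forall>z\<in>U_I H i. form H v_I z = form H (avg H i (w_Delta + c)) z"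
    and c: "c = precond n (Suc i) (averaged_residual i r)" and n: "Suc i + n = L"
  have w_eq: "w_Delta = riesz (W_Delta H i) (averaged_residual i r)"
    using w av inclusions(2)[OF i]
    by (intro riesz_unique[OF test_spaces(6,5)[OF i] subspaces(3)[OF i] lin(4)]) auto
  have "c \<in> U_space H (Suc i)"
    unfolding c using n levels_ge_2 by (intro precond_in_U[OF _ _ _ lin(5)]) auto
  then have "w_Delta + c \<in> W_tilde H i"
    using w(1) coarse_subset[OF i] inclusions(2)[OF i] subspaces(4)[OF i]
    by (blast intro: subspace_add)
  then have "avg H i (w_Delta + c) \<in> W1"
    using projectionD(2)[OF i] test_spaces(1)[OF i] by blast
  then have "v_I = riesz (U_I H i) (form H (avg H i (w_Delta + c)))"
    using v by (intro riesz_unique[OF test_spaces(4,3)[OF i] subspaces(2)[OF i]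
      linear_map_on_form[OF _ test_spaces(3)[OF i]]]) auto
  then show "u_I + avg H i (w_Delta + c) - v_I = precond (Suc n) i r"
    by (simp add: interior_correction_def uI_eq w_eq c)
qed

text \<open>
  The residuals \<open>r i\<close> produced on the way down. The algorithm starts at level 1, so that the value at 0 is
  a dummy.
\<close>

primrec residuals :: "('d field \<Rightarrow> real) \<Rightarrow> nat \<Rightarrow> 'd field \<Rightarrow> real" where
  "residuals r 0 = r"
| "residuals r (Suc i) =
     (if i = 0 then r else restrict (averaged_residual i (residuals r i)) (U_space H (Suc i)))"

lemma residuals_dual:
  assumes r: "r \<in> dual (U_space H 1)"
  shows "i \<in> {1..L} \<Longrightarrow> residuals r i \<in> dual (U_space H i)"
proof (induction i)
  case (Suc i)
  show ?case
  proof (cases "i = 0")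
    case False
    then have i: "i \<in> {1..<L}" using Suc.prems by auto
    then have "linear_map_on (U_space H i) (residuals r i)" using Suc.IH by (auto simp: dual_def)
    from restrict_dual[OF coarse_subspace[OF i] linear_residuals(5)[OF i this]] False show ?thesis
      by (simp only: residuals.simps if_False)
  qed (use r in auto)
qed auto


text \<open>
  Uniqueness of the result: by induction from the coarsest level upwards, the value \<open>u i\<close> of any run
  is the recursively defined preconditioner applied to its residual \<open>r i\<close>.
\<close>

lemma run_imp_precond:
  assumes "bddc_run H r\<^sub>1 u\<^sub>1"
  shows "u\<^sub>1 = precond (L - 1) 1 r\<^sub>1"
proof -
  from assms obtain r r_B u_I w_Delta u_B v_I u where
    start: "r 1 = r\<^sub>1" "u 1 = u\<^sub>1" and
    run: "\<forall>i\<in>{1..<L}.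
           r i \<in> dual (U_space H i) \<and>
           u_I i \<in> U_I H i \<and> (\<forall>z\<in>U_I H i. form H (u_I i) z = r i z) \<and>
           r_B i \<in> dual (U_space H i) \<and> (\<forall>v\<in>U_space H i. r_B i v = r i v - form H (u_I i) v) \<and>
           w_Delta i \<in> W_Delta H i \<and>
           (\<forall>z\<in>W_Delta H i. form H (w_Delta i) z = r_B i (avg H i z)) \<and>
           (if i = L - 1
            then u (i + 1) \<in> W_Pi H i \<and>
                 (\<forall>z\<in>W_Pi H i. form H (u (i + 1)) z = r_B i (avg H i z))
            else r (i + 1) \<in> dual (U_space H (i + 1)) \<and>
                 (\<forall>z\<in>U_space H (i + 1). r (i + 1) z = r_B i (avg H i z))) \<and>
           u_B i = avg H i (w_Delta i + u (i + 1)) \<and>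
           v_I i \<in> U_I H i \<and> (\<forall>z\<in>U_I H i. form H (v_I i) z = form H (u_B i) z) \<and>
           u i = u_I i + u_B i - v_I i"
    unfolding bddc_run_def by (elim exE conjE) (rule that; assumption)
  have "u i = precond (Suc n) i (r i)" if "i + Suc n = L" "i \<in> {1..<L}" for n i
    using that
  proof (induction n arbitrary: i)
    case (0 i)
    note R = run[rule_format, OF 0(2)]
    have r: "linear_map_on (U_space H i) (r i)" using R by (simp add: dual_def)
    have last: "i = L - 1" using 0(1) by simp
    have av: "r_B i (avg H i z) = averaged_residual i (r i) z" if "z \<in> W_tilde H i" for z
      using precond_step(1)[OF 0(2) r, of "u_I i" "r_B i"] R that by blast
    have "u (Suc i) = precond 0 (Suc i) (averaged_residual i (r i))"
      unfolding precond.simps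
    proof (rule riesz_unique[OF test_spaces(8,7)[OF 0(2)] coarse_subspace[OF 0(2)] linear_residuals(5)[OF 0(2) r]])
      have c: "u (Suc i) \<in> W_Pi H i" "\<forall>z\<in>W_Pi H i. form H (u (Suc i)) z = r_B i (avg H i z)"
        using R last by simp_all
      from c(1) show "u (Suc i) \<in> U_space H (Suc i)" by (simp only: U_space_Suc[OF 0(2)])
      fix z assume z: "z \<in> U_space H (Suc i)"
      then show "form H (u (Suc i)) z = averaged_residual i (r i) z"
        using c(2) av[of z] coarse_subset[OF 0(2)] unfolding U_space_Suc[OF 0(2)] by auto
    qed
    then show ?case
      using precond_step(2)[OF 0(2) r, of "u_I i" "r_B i" "w_Delta i" "v_I i" "u (Suc i)" 0] R 0(1)
      by simp
  next
    case (Suc n i)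
    note R = run[rule_format, OF Suc.prems(2)]
    have r: "linear_map_on (U_space H i) (r i)" using R by (simp add: dual_def)
    have i: "i \<noteq> L - 1" "Suc i \<in> {1..<L}" "Suc i + Suc n = L" using Suc.prems by auto
    have av: "r_B i (avg H i z) = averaged_residual i (r i) z" if "z \<in> W_tilde H i" for z
      using precond_step(1)[OF Suc.prems(2) r, of "u_I i" "r_B i"] R that by blast
    have "u (Suc i) = precond (Suc n) (Suc i) (r (Suc i))" by (rule Suc.IH[OF i(3,2)])
    also have "\<dots> = precond (Suc n) (Suc i) (averaged_residual i (r i))"
    proof (rule precond_cong)
      fix z assume z: "z \<in> U_space H (Suc i)"
      then show "r (Suc i) z = averaged_residual i (r i) z"
        using R i(1) av coarse_subset[OF Suc.prems(2)] by auto
    qed (use i in auto)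
    finally show ?case
      using precond_step(2)[OF Suc.prems(2) r, of "u_I i" "r_B i" "w_Delta i" "v_I i" "u (Suc i)" "Suc n"]
        R i(3) by simp
  qed
  from this[of 1 "L - 2"] show ?thesis using levels_ge_2 start by (simp add: numeral_2_eq_2 Suc_diff_Suc)
qed

text \<open>
  Existence: the residuals are computed downwards, all other quantities from them.
\<close>

lemma precond_run:
  assumes r1: "r\<^sub>1 \<in> dual (U_space H 1)"
  shows "bddc_run H r\<^sub>1 (precond (L - 1) 1 r\<^sub>1)"
proof -
  define r where "r = residuals r\<^sub>1"
  define r_B where "r_B i = restrict (interior_residual i (r i)) (U_space H i)" for i
  define u_I where "u_I i = riesz (U_I H i) (r i)" for i
  define w_Delta where "w_Delta i = riesz (W_Delta H i) (averaged_residual i (r i))" for i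
  define u where "u i = precond (L - i) i (r i)" for i
  define u_B where "u_B i = avg H i (w_Delta i + u (i + 1))" for i
  define v_I where "v_I i = riesz (U_I H i) (form H (u_B i))" for i
  have start: "r 1 = r\<^sub>1" "u 1 = precond (L - 1) 1 r\<^sub>1" by (simp_all add: r_def u_def)
  have step: "r i \<in> dual (U_space H i) \<and>
           u_I i \<in> U_I H i \<and> (\<forall>z\<in>U_I H i. form H (u_I i) z = r i z) \<and>
           r_B i \<in> dual (U_space H i) \<and> (\<forall>v\<in>U_space H i. r_B i v = r i v - form H (u_I i) v) \<and>
           w_Delta i \<in> W_Delta H i \<and>
           (\<forall>z\<in>W_Delta H i. form H (w_Delta i) z = r_B i (avg H i z)) \<and>
           (if i = L - 1
            then u (i + 1) \<in> W_Pi H i \<and>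
                 (\<forall>z\<in>W_Pi H i. form H (u (i + 1)) z = r_B i (avg H i z))
            else r (i + 1) \<in> dual (U_space H (i + 1)) \<and>
                 (\<forall>z\<in>U_space H (i + 1). r (i + 1) z = r_B i (avg H i z))) \<and>
           u_B i = avg H i (w_Delta i + u (i + 1)) \<and>
           v_I i \<in> U_I H i \<and> (\<forall>z\<in>U_I H i. form H (v_I i) z = form H (u_B i) z) \<and>
           u i = u_I i + u_B i - v_I i" if i: "i \<in> {1..<L}" for i
  proof -
    have rd: "r j \<in> dual (U_space H j)" if "j \<in> {1..L}" for j
      using residuals_dual[OF r1 that] by (simp add: r_def)
    have r: "linear_map_on (U_space H i) (r i)" using rd[of i] i by (simp add: dual_def)
    note lin = linear_residuals[OF i r]
    note RI = riesz[OF test_spaces(4,3)[OF i] subspaces(2)[OF i]]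
    note RD = riesz[OF test_spaces(6,5)[OF i] subspaces(3)[OF i] lin(4)]
    note RC = riesz[OF test_spaces(8,7)[OF i] coarse_subspace[OF i] lin(5)]
    have av: "r_B i (avg H i z) = averaged_residual i (r i) z" if "z \<in> W_tilde H i" for z
      using projectionD(2)[OF i that] by (simp add: r_B_def averaged_residual_def)
    have rB: "r_B i \<in> dual (U_space H i)"
      unfolding r_B_def by (rule restrict_dual[OF subspaces(1)[OF i] lin(2)])
    have rS: "r (Suc i) z = averaged_residual i (r i) z" if "z \<in> U_space H (Suc i)" for z
      using that i by (simp add: r_def)
    have uS: "u (Suc i) = precond (L - Suc i) (Suc i) (averaged_residual i (r i))"
      unfolding u_def using i rS by (intro precond_cong) auto
    have "u (Suc i) \<in> U_space H (Suc i)"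
      unfolding u_def using i levels_ge_2 rd[of "Suc i"] by (intro precond_in_U) (auto simp: dual_def)
    then have "w_Delta i + u (Suc i) \<in> W_tilde H i"
      using RD(1) coarse_subset[OF i] inclusions(2)[OF i] subspaces(4)[OF i]
      unfolding w_Delta_def by (blast intro: subspace_add)
    then have uB: "u_B i \<in> U_space H i"
      unfolding u_B_def using projectionD(2)[OF i] by simp
    then have uBl: "linear_map_on (U_I H i) (form H (u_B i))"
      using test_spaces(1,3)[OF i] by (intro linear_map_on_form) auto
    have "L - i = Suc (L - Suc i)" using i by auto
    then have "u i = u_I i + u_B i - v_I i"
      by (simp add: u_def u_I_def u_B_def v_I_def w_Delta_def uS[unfolded u_def] interior_correction_def)
    moreover have "if i = L - 1
        then u (i + 1) \<in> W_Pi H i \<and> (\<forall>z\<in>W_Pi H i. form H (u (i + 1)) z = r_B i (avg H i z))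
        else r (i + 1) \<in> dual (U_space H (i + 1)) \<and>
          (\<forall>z\<in>U_space H (i + 1). r (i + 1) z = r_B i (avg H i z))"
    proof (cases "i = L - 1")
      case True
      then have "u (Suc i) = riesz (U_space H (Suc i)) (averaged_residual i (r i))"
        using uS i by simp
      then show ?thesis
        using RC av coarse_subset[OF i] True unfolding U_space_Suc[OF i] by auto
    next
      case False
      then show ?thesis using rd[of "Suc i"] i rS av coarse_subset[OF i] by auto
    qed
    moreover have "u_I i \<in> U_I H i" "\<forall>z\<in>U_I H i. form H (u_I i) z = r i z"
      using RI[OF lin(1)] by (simp_all add: u_I_def)
    moreover have "v_I i \<in> U_I H i" "\<forall>z\<in>U_I H i. form H (v_I i) z = form H (u_B i) z"
      using RI[OF uBl] by (simp_all add: v_I_def)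
    moreover have "w_Delta i \<in> W_Delta H i"
        "\<forall>z\<in>W_Delta H i. form H (w_Delta i) z = r_B i (avg H i z)"
      using RD av inclusions(2)[OF i] by (auto simp: w_Delta_def)
    moreover have "\<forall>v\<in>U_space H i. r_B i v = r i v - form H (u_I i) v"
      by (simp add: r_B_def interior_residual_def u_I_def)
    moreover have "r i \<in> dual (U_space H i)" using rd[of i] i by simp
    moreover have "u_B i = avg H i (w_Delta i + u (i + 1))" by (simp add: u_B_def)
    ultimately show ?thesis
      using rB by (intro conjI)
  qed
  show ?thesis
    unfolding bddc_run_def
    by (rule exI[of _ r], rule exI[of _ r_B], rule exI[of _ u_I], rule exI[of _ w_Delta],
        rule exI[of _ u_B], rule exI[of _ v_I], rule exI[of _ u])
      (intro conjI ballI start step)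
qed

lemma bddc_run_ex1: "r \<in> dual (U_space H 1) \<Longrightarrow> \<exists>!u. bddc_run H r u"
  using run_imp_precond precond_run by metis

lemma bddc_eq_precond: "r \<in> dual (U_space H 1) \<Longrightarrow> bddc H r = precond (L - 1) 1 r"
  unfolding bddc_def using run_imp_precond precond_run by (intro the_equality) auto

lemma bddc_A_op:
  assumes u: "u \<in> U_space H 1"
  shows "bddc H (A_op H u) = precond (L - 1) 1 (form H u)"
proof -
  have "1 \<in> {1..<L}" by (rule levels_ge_2(2))
  note U = test_spaces(1)[OF this] subspaces(1)[OF this]
  have "linear_map_on (U_space H 1) (form H u)" using U u by (intro linear_map_on_form) auto
  then have "A_op H u \<in> dual (U_space H 1)"
    unfolding A_op_def by (rule restrict_dual[OF U(2)])
  then have "bddc H (A_op H u) = precond (L - 1) 1 (A_op H u)" by (rule bddc_eq_precond)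
  also have "\<dots> = precond (L - 1) 1 (form H u)"
    using levels_ge_2 by (intro precond_cong) (auto simp: A_op_def)
  finally show ?thesis .
qed

end

theorem lemma20:
  fixes H :: "('d::finite) hierarchy" and \<omega> :: "nat \<Rightarrow> real"
  assumes "bddc_setting H"
    and "U_space H 1 \<noteq> {0}"
    and "\<forall>i\<in>{1..<levels H}. 1 \<le> \<omega> i"
    and "\<forall>i\<in>{1..<levels H}. \<forall>w\<in>W_tilde H i.
           energy H (avg H i w - P_int H i (avg H i w)) \<le> \<omega> i * energy H w"
  shows "(\<forall>r\<in>dual (U_space H 1). \<exists>!u. bddc_run H r u) \<and>
         finite (BA_eigenvalues H) \<and> BA_eigenvalues H \<noteq> {} \<and> 0 < Min (BA_eigenvalues H) \<and>
         Max (BA_eigenvalues H) / Min (BA_eigenvalues H) \<le> (\<Prod>i\<in>{1..<levels H}. \<omega> i)"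
proof -
  interpret bddc_hierarchy_bounded H \<omega>
    by unfold_locales (use assms in auto)
  have "finite (BA_eigenvalues H) \<and> BA_eigenvalues H \<noteq> {} \<and> 0 < Min (BA_eigenvalues H) \<and>
         Max (BA_eigenvalues H) / Min (BA_eigenvalues H) \<le> (\<Prod>i\<in>{1..<levels H}. \<omega> i)"
    unfolding BA_eigenvalues_def
    by (rule condition_number_bound[OF levels_ge_2(1) assms(2)]) (rule bddc_A_op)
  moreover have "\<forall>r\<in>dual (U_space H 1). \<exists>!u. bddc_run H r u"
    by (intro ballI bddc_run_ex1)
  ultimately show ?thesis by (intro conjI) (elim conjE; assumption)+
qed

end
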